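(* Let $C\subset\mathbb{R}^n$ be a closed convex cone that is pointed (contains no line) and has interior points. Let $\mu$ be a Borel probability measure on $\Omega_{C^\circ}$ and let $\nu$ be a Borel probability measure on $\Omega_C$, and suppose that $\mu$ is zero on sets of Hausdorff dimension at most $n-2$. Then there exists a $C$-pseudo-cone $K$ such that $(\alpha_K^* )_\sharp\mu=\nu$, where $\alpha_K^*$ is the reverse radial Gauss map of $K$; that is, $\mu\big((\alpha_K^* )^{-1}(\eta)\big)=\nu(\eta)$ for every Borel set $\eta\subseteq\Omega_C$.
   Context: Notation: $\mathbb{S}^{n-1}$ is the unit sphere of $\mathbb{R}^n$, $\langle\cdot,\cdot\rangle$ is the scalar product, $\operatorname{int}$, $\operatorname{cl}$, $\operatorname{bd}$ denote interior, closure, boundary. The dual cone of $C$ is $C^\circ=\{x\in\mathbb{R}^n:\langle x,y\rangle\le 0\ \forall y\in C\}$. Put $\Omega_C=\mathbb{S}^{n-1}\cap\operatorname{int}C$ and $\Omega_{C^\circ}=\mathbb{S}^{n-1}\cap\operatorname{int}C^\circ$. A $C$-pseudo-cone is a nonempty closed convex set $K\subset C$ not containing the origin and satisfying $K+C=K$. The radial function $\rho_K:\Omega_C\to(0,\infty)$ of a $C$-pseudo-cone $K$ is $\rho_K(v)=\min\{r>0: rv\in K\}$; thus $\rho_K(v)v\in\operatorname{bd}K$. "Normal vector" always means outer unit normal vector: $u\in\mathbb{S}^{n-1}$ is a normal vector of $K$ at $x\in K$ if $\langle u,y\rangle\le\langle u,x\rangle$ for all $y\in K$. Let $\omega_K$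 be the set of all $u\in\operatorname{cl}\Omega_{C^\circ}$ such that $u$ is a normal vector of $K$ at more than one point of $K$ (this set has Hausdorff dimension at most $n-2$). For $u\in\Omega_{C^\circ}\setminus\omega_K$ there is exactly one point of $K$ at which $u$ is a normal vector. The reverse radial Gauss map $\alpha_K^*$, defined on $\Omega_{C^\circ}\setminus\omega_K$, assigns to $u$ the unique unit vector $v$ such that this point is a positive multiple of $v$; for $v\in\Omega_C$ the point is $\rho_K(v)v$. For a Borel set $\eta\subseteq\Omega_C$, $(\alpha_K^* )^{-1}(\eta)$ denotes the set of all $u\in\Omega_{C^\circ}\setminus\omega_K$ with $\alpha_K^*(u)\in\eta$, equivalently those $u\in\Omega_{C^\circ}\setminus\omega_K$ for which there is $v\in\eta$ such that $u$ is a normal vector of $K$ at $\rho_K(v)v$. *)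

theory Defs
  imports "HOL-Probability.Probability"
begin

text \<open>
  The summand \<open>(diam U)^s\<close>, with the usual conventions that the empty set contributes \<open>0\<close>
  and that \<open>0^0 = 1\<close>. The case \<open>s = 0\<close> is separate because \<open>0 powr 0 = 0\<close>.
\<close>

definition hausdorff_gauge :: "real \<Rightarrow> 'a::metric_space set \<Rightarrow> ennreal" where
  "hausdorff_gauge s U =
     (if U = {} then 0 else if s = 0 then 1 else ennreal (diameter U powr s))"

text \<open>
  Covering sets are required to be bounded because \<open>diameter\<close> is a real supremum and carries
  no information for unbounded sets.
\<close>

definition hausdorff_premeasure :: "real \<Rightarrow> real \<Rightarrow> 'a::metric_space set \<Rightarrow> ennreal" where
  "hausdorff_premeasure s \<delta> A =
     (INF U \<in> {U :: nat \<Rightarrow> 'a set.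
                 A \<subseteq> (\<Union>i. U i) \<and> (\<forall>i. bounded (U i) \<and> diameter (U i) \<le> \<delta>)}.
        \<Sum>i. hausdorff_gauge s (U i))"

definition hausdorff_measure :: "real \<Rightarrow> 'a::metric_space set \<Rightarrow> ennreal" where
  "hausdorff_measure s A = (SUP \<delta> \<in> {0<..}. hausdorff_premeasure s \<delta> A)"

definition hausdorff_dim :: "'a::metric_space set \<Rightarrow> ereal" where
  "hausdorff_dim A = Inf {ereal s | s. 0 \<le> s \<and> hausdorff_measure s A = 0}"

definition contains_line :: "'a::real_vector set \<Rightarrow> bool" where
  "contains_line S \<longleftrightarrow> (\<exists>x d. d \<noteq> 0 \<and> (\<forall>t::real. x + t *\<^sub>R d \<in> S))"

definition dual_cone :: "'a::real_inner set \<Rightarrow> 'a set" where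
  "dual_cone C = {x. \<forall>y\<in>C. x \<bullet> y \<le> 0}"

definition Omega :: "'a::real_inner set \<Rightarrow> 'a set" where
  "Omega C = sphere 0 1 \<inter> interior C"

text \<open>Here \<open>K + C\<close> is the Minkowski sum.\<close>

definition pseudo_cone :: "'a::real_inner set \<Rightarrow> 'a set \<Rightarrow> bool" where
  "pseudo_cone C K \<longleftrightarrow>
     K \<noteq> {} \<and> closed K \<and> convex K \<and> K \<subseteq> C \<and> 0 \<notin> K \<and> K + C = K"

definition normal_vector :: "'a::real_inner set \<Rightarrow> 'a \<Rightarrow> 'a \<Rightarrow> bool" where
  "normal_vector K x u \<longleftrightarrow> x \<in> K \<and> u \<in> sphere 0 1 \<and> (\<forall>y\<in>K. u \<bullet> y \<le> u \<bullet> x)"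

definition omega :: "'a::real_inner set \<Rightarrow> 'a set \<Rightarrow> 'a set" where
  "omega C K = {u \<in> closure (Omega (dual_cone C)).
     \<exists>x y. x \<noteq> y \<and> normal_vector K x u \<and> normal_vector K y u}"

text \<open>
  The direction of the point of \<open>K\<close> with normal vector \<open>u\<close>. The value is meaningful only on
  \<open>Omega (dual_cone C) - omega C K\<close>, where that point exists and is unique; elsewhere the
  description need not denote anything, so preimages are always restricted to this domain.
\<close>

definition reverse_radial_gauss :: "'a::real_inner set \<Rightarrow> 'a \<Rightarrow> 'a" where
  "reverse_radial_gauss K u =
     (THE v. v \<in> sphere 0 1 \<and> (\<exists>r>0. normal_vector K (r *\<^sub>R v) u))"

definition reverse_radial_gauss_preimage ::
    "'a::real_inner set \<Rightarrow> 'a set \<Rightarrow> 'a set \<Rightarrow> 'a set" where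
  "reverse_radial_gauss_preimage C K \<eta> =
     {u \<in> Omega (dual_cone C) - omega C K. reverse_radial_gauss K u \<in> \<eta>}"

end

(*
  For a pseudo-cone K let h(u) = min over x in K of - (u . x). The point x(u) attaining the minimum
  is unique for u outside omega_K, and alpha*_K(u) = x(u) / |x(u)|.

  If nu is carried by finitely many directions v_i, then K is the C-hull of points r_i v_i, and the
  exponents t_i = ln r_i maximise a concave functional (semi-discrete optimal transport for the cost
  ln (- (u . v))). In general nu is a limit of discrete measures. Normalising the discrete solutions
  at one direction u0, the functions h are bounded above and below on every direction, since they are
  positive, superadditive and homogeneous. A subsequence converges on a countable dense set to the
  h of a pseudo-cone K, and the minimisers x_N(u) converge to x(u) for all u outside omega_K. As
  omega_K is mu-null, dominated convergence identifies the image measure of mu with nu.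
*)

theory Submission
  imports Defs
begin

section \<open>Compactness and Hausdorff dimension\<close>

text \<open>The logarithm is what makes this a transport problem: the minimum over i of r_i (-(u .
  v_i)) becomes a minimum of t_i + c_i(u), and prescribing the masses of the cells is the
  first-order condition for the t_i. The obstacle is that the cost ln (-(u . v)) can be unbounded
  over all pairs (u, v). For finitely many directions v_i interior to C it is bounded uniformly in
  u, so the discrete problem has a maximiser, but this bound does not survive the limit; what
  survives are estimates for each single u. Dilating K changes no direction, which permits the
  normalisation. The hypothesis on mu enters twice, through the same lemma: for two-point sets it
  removes ties between cells, for the limit K it removes omega_K. No discrete pseudo-cone is ever
  built; a discrete solution is only a selection of optimal points. Measurability of the limit map
  is inherited from the selections, and escape of mass to the boundary of C is excluded only at the
  end, by comparing measures on the whole space.\<close>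

lemma compact_fun_box:
  fixes a b :: "nat \<Rightarrow> real"
  shows "compact {t. \<forall>i. a i \<le> t i \<and> t i \<le> b i}"
proof -
  have "{t. \<forall>i. a i \<le> t i \<and> t i \<le> b i} = PiE UNIV (\<lambda>i. {a i..b i})"
    by (auto simp: PiE_def Pi_def)
  moreover have "compactin (product_topology (\<lambda>i. euclidean) UNIV) (PiE UNIV (\<lambda>i. {a i..b i}))"
    unfolding compactin_PiE by (simp add: compactin_euclidean_iff)
  ultimately show ?thesis
    by (simp add: euclidean_product_topology)
qed

text \<open>Tychonoff's theorem replaces the diagonal argument: a countable product of lines is
  metrisable, so the compact box is sequentially compact. The lower bound on the limits later keeps
  the origin out of K.\<close>

lemma bounded_nat_sequences_converge_simultaneously:
  fixes f :: "nat \<Rightarrow> nat \<Rightarrow> real"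
  assumes "\<And>N i. a i \<le> f N i \<and> f N i \<le> b i"
  obtains r l where "strict_mono r" "\<And>i. (\<lambda>N. f (r N) i) \<longlonglongrightarrow> l i" "\<And>i. a i \<le> l i"
proof -
  have "seq_compact {t. \<forall>i. a i \<le> t i \<and> t i \<le> b i}"
    using compact_fun_box[of a b] by (simp only: compact_eq_seq_compact_metric)
  then obtain l r where l: "l \<in> {t. \<forall>i. a i \<le> t i \<and> t i \<le> b i}" "strict_mono r" "(f \<circ> r) \<longlonglongrightarrow> l"
    using assms by (elim seq_compactE[where f=f]) blast+
  have "(\<lambda>N. f (r N) i) \<longlonglongrightarrow> l i" for i
  proof -
    have "continuous_on UNIV (\<lambda>t :: nat \<Rightarrow> real. t i)" by simp
    from continuous_on_tendsto_compose[OF this l(3)] show ?thesis by (simp add: o_def)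
  qed
  with l(1,2) show ?thesis by (intro that[of r l]) blast+
qed

text \<open>Terms that stay away from l infinitely often would, by boundedness, have a convergent
  subsequence with another limit.\<close>

lemma tendsto_of_unique_subsequential_limit:
  fixes x :: "nat \<Rightarrow> 'a::heine_borel"
  assumes "bounded (range x)"
    and uniq: "\<And>r y. strict_mono r \<Longrightarrow> (x \<circ> r) \<longlonglongrightarrow> y \<Longrightarrow> y = l"
  shows "x \<longlonglongrightarrow> l"
proof (rule ccontr)
  assume "\<not> x \<longlonglongrightarrow> l"
  then obtain e where e: "e > 0" "\<not> (\<forall>\<^sub>F n in sequentially. dist (x n) l < e)"
    by (auto simp: tendsto_iff)
  then have "\<exists>\<^sub>F n in sequentially. dist (x n) l \<ge> e"
    by (simp add: frequently_def not_le)
  then have "infinite {n. dist (x n) l \<ge> e}"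
    by (simp add: frequently_cofinite cofinite_eq_sequentially[symmetric])
  then obtain r :: "nat \<Rightarrow> nat" where r: "strict_mono r" "\<And>n. dist (x (r n)) l \<ge> e"
    using infinite_enumerate by (metis mem_Collect_eq)
  have "bounded (range (x \<circ> r))"
    using assms(1) by (rule bounded_subset) auto
  then obtain y s where s: "strict_mono s" "((x \<circ> r) \<circ> s) \<longlonglongrightarrow> y"
    using bounded_imp_convergent_subsequence by blast
  have "y = l"
    using uniq[of "r \<circ> s" y] s r(1) by (simp add: strict_mono_o o_assoc)
  with s have "(\<lambda>n. dist (x (r (s n))) l) \<longlonglongrightarrow> 0"
    using tendsto_dist[OF s(2) tendsto_const, of l] by (simp add: o_def)
  then have "e \<le> 0"
    using r(2) by (intro LIMSEQ_le_const) auto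
  with e show False by simp
qed

section \<open>Hausdorff dimension estimates from finite covers\<close>

lemma hausdorff_premeasure_le:
  assumes "A \<subseteq> (\<Union>i. U i)" "\<And>i. bounded (U i)" "\<And>i. diameter (U i) \<le> \<delta>"
  shows "hausdorff_premeasure s \<delta> A \<le> (\<Sum>i. hausdorff_gauge s (U i))"
  unfolding hausdorff_premeasure_def using assms by (intro INF_lower) auto

lemma hausdorff_premeasure_le_finite_cover:
  assumes I: "finite I" and cov: "A \<subseteq> (\<Union>i\<in>I. U i)" and s: "s > 0" and e: "0 \<le> e" "e \<le> \<delta>"
    and d: "\<And>i x y. i \<in> I \<Longrightarrow> x \<in> U i \<Longrightarrow> y \<in> U i \<Longrightarrow> dist x y \<le> e"
  shows "hausdorff_premeasure s \<delta> A \<le> ennreal (real (card I) * e powr s)"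
proof -
  obtain h where h: "bij_betw h {0..<card I} I"
    using ex_bij_betw_nat_finite[OF I] by blast
  \<comment> \<open>The premeasure asks for a sequence of sets; padding with the empty set is free
    because its gauge is 0.\<close>
  define V where "V n = (if n < card I then U (h n) else {})" for n
  have hI: "h n \<in> I" if "n < card I" for n
    using bij_betwE[OF h] that by auto
  have diam: "bounded (V n)" "diameter (V n) \<le> e" for n
  proof -
    show "bounded (V n)"
      unfolding bounded_two_points V_def using d[OF hI] by (auto intro!: exI[of _ e])
    show "diameter (V n) \<le> e"
      using e d[OF hI] by (auto simp: diameter_def V_def split: if_splits intro!: cSUP_least)
  qed
  have "A \<subseteq> (\<Union>n. V n)"
  proof
    fix x assume "x \<in> A"
    then obtain i where "i \<in> I" "x \<in> U i" using cov by auto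
    moreover obtain n where "n < card I" "h n = i"
      using h \<open>i \<in> I\<close> unfolding bij_betw_def by (metis atLeastLessThan_iff imageE)
    ultimately show "x \<in> (\<Union>n. V n)" by (auto simp: V_def intro!: exI[of _ n])
  qed
  then have "hausdorff_premeasure s \<delta> A \<le> (\<Sum>n. hausdorff_gauge s (V n))"
    using diam e by (intro hausdorff_premeasure_le) (auto intro: order_trans)
  also have "\<dots> = (\<Sum>n<card I. hausdorff_gauge s (V n))"
    by (intro suminf_finite) (auto simp: V_def hausdorff_gauge_def)
  also have "\<dots> \<le> (\<Sum>n<card I. ennreal (e powr s))"
    using diam s diameter_ge_0 by (intro sum_mono) (auto simp: hausdorff_gauge_def intro!: ennreal_leI powr_mono2)
  also have "\<dots> = ennreal (real (card I) * e powr s)"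
    by (simp add: ennreal_mult ennreal_of_nat_eq_real_of_nat)
  finally show ?thesis .
qed

text \<open>The coordinates f map A injectively, with Lipschitz inverse, to a bounded subset of a
  space of dimension d = card D. A grid of mesh 1/k there pulls back to at most (2kR + 1)^d cells of
  diameter at most M d / k, and for s > d the resulting sum tends to 0.\<close>

lemma hausdorff_dim_le_card_coordinates:
  fixes A :: "'a::metric_space set" and f :: "'a \<Rightarrow> 'b \<Rightarrow> real" and R :: nat
  assumes D: "finite D" and R: "\<And>x b. x \<in> A \<Longrightarrow> b \<in> D \<Longrightarrow> \<bar>f x b\<bar> \<le> real R"
    and M: "M \<ge> 0" "\<And>x y. x \<in> A \<Longrightarrow> y \<in> A \<Longrightarrow> dist x y \<le> M * (\<Sum>b\<in>D. \<bar>f x b - f y b\<bar>)"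
  shows "hausdorff_dim A \<le> ereal (real (card D))"
proof -
  define d where "d = card D"
  have zero: "hausdorff_measure s A = 0" if s: "s > real d" for s
  proof -
    have "hausdorff_premeasure s \<delta> A \<le> 0" if \<delta>: "\<delta> > 0" for \<delta>
    proof -
      \<comment> \<open>For k at least 1, 2kR + 1 is at most (2R + 1) k; \<open>K\<close> collects
        the factors of the covering sum that do not depend on k.\<close>
      define K where "K = (2 * real R + 1) ^ d * (M * d) powr s"
      have ev: "\<forall>\<^sub>F k in sequentially. hausdorff_premeasure s \<delta> A \<le> ennreal (K * real k powr (d - s))"
      proof -
        have "(\<lambda>k. M * d / real k) \<longlonglongrightarrow> 0"
          by (rule lim_const_over_n)
        then have "\<forall>\<^sub>F k in sequentially. M * d / real k < \<delta>"
          using \<delta> by (rule order_tendstoD)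
        then show ?thesis using eventually_gt_at_top[of 0]
        proof eventually_elim
          fix k :: nat assume k: "M * d / real k < \<delta>" "k > 0"
          define I where "I = PiE D (\<lambda>_. {- int (k * R)..int (k * R)})"
          define U where "U \<sigma> = {x \<in> A. \<forall>b\<in>D. \<lfloor>k * f x b\<rfloor> = \<sigma> b}" for \<sigma> :: "'b \<Rightarrow> int"
          have "card I = (2 * k * R + 1) ^ d"
            unfolding I_def d_def using D by (simp add: card_PiE nat_add_distrib nat_mult_distrib algebra_simps)
          then have cI: "real (card I) \<le> ((2 * real R + 1) * k) ^ d"
            using k by (auto intro!: power_mono simp: algebra_simps)
          have fl: "\<lfloor>k * f x b\<rfloor> \<in> {- int (k * R)..int (k * R)}" if "x \<in> A" "b \<in> D" for x b
          proof -
            have "\<bar>k * f x b\<bar> \<le> real (k * R)"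
              using R[OF that] by (simp add: abs_mult mult_left_mono)
            then show ?thesis by (auto simp: le_floor_iff floor_le_iff abs_le_iff)
          qed
          have cov: "A \<subseteq> (\<Union>\<sigma>\<in>I. U \<sigma>)"
          proof
            fix x assume "x \<in> A"
            then have "restrict (\<lambda>b. \<lfloor>k * f x b\<rfloor>) D \<in> I" "x \<in> U (restrict (\<lambda>b. \<lfloor>k * f x b\<rfloor>) D)"
              using fl by (auto simp: I_def U_def)
            then show "x \<in> (\<Union>\<sigma>\<in>I. U \<sigma>)" by blast
          qed
          have "hausdorff_premeasure s \<delta> A \<le> ennreal (real (card I) * (M * d / k) powr s)"
          proof (rule hausdorff_premeasure_le_finite_cover[OF _ cov])
            show "finite I" using D by (simp add: I_def finite_PiE)
            show "s > 0" using s by simp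
            show "0 \<le> M * d / k" "M * d / k \<le> \<delta>" using M k by auto
            fix \<sigma> x y assume *: "\<sigma> \<in> I" "x \<in> U \<sigma>" "y \<in> U \<sigma>"
            have "\<bar>f x b - f y b\<bar> \<le> 1 / k" if "b \<in> D" for b
            proof -
              have "\<lfloor>k * f x b\<rfloor> = \<lfloor>k * f y b\<rfloor>" using * that by (auto simp: U_def)
              then have "\<bar>k * f x b - k * f y b\<bar> \<le> 1" by linarith
              then have "k * \<bar>f x b - f y b\<bar> \<le> 1"
                by (simp add: abs_mult right_diff_distrib[symmetric])
              then show ?thesis using k by (simp add: field_simps)
            qed
            then have "(\<Sum>b\<in>D. \<bar>f x b - f y b\<bar>) \<le> d * (1 / k)"
              unfolding d_def by (intro sum_bounded_above) auto
            then have "M * (\<Sum>b\<in>D. \<bar>f x b - f y b\<bar>) \<le> M * (d * (1 / k))"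
              using M by (intro mult_left_mono)
            moreover have "dist x y \<le> M * (\<Sum>b\<in>D. \<bar>f x b - f y b\<bar>)"
              using * by (intro M) (auto simp: U_def)
            ultimately show "dist x y \<le> M * d / k" by simp
          qed
          also have "\<dots> \<le> ennreal (((2 * real R + 1) * k) ^ d * (M * d / k) powr s)"
            using cI by (intro ennreal_leI mult_right_mono) auto
          also have "((2 * real R + 1) * k) ^ d * (M * d / k) powr s = K * real k powr (d - s)"
          proof -
            have "(M * d / k) powr s = (M * d) powr s / k powr s"
              using M(1) by (subst powr_divide) auto
            moreover have "real k powr (d - s) = real k ^ d / k powr s"
              using k by (simp add: powr_diff powr_realpow)
            ultimately show ?thesis
              unfolding K_def power_mult_distrib by simp
          qed
          finally show "hausdorff_premeasure s \<delta> A \<le> ennreal (K * real k powr (d - s))" .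
        qed
      qed
      have "(\<lambda>k. K * real k powr (d - s)) \<longlonglongrightarrow> K * 0"
        using s by (intro tendsto_mult tendsto_const tendsto_neg_powr) (auto simp: filterlim_real_sequentially)
      then have "(\<lambda>k. ennreal (K * real k powr (d - s))) \<longlonglongrightarrow> ennreal 0"
        by (intro tendsto_ennrealI) simp
      from tendsto_lowerbound[OF this ev] show ?thesis by simp
    qed
    then show ?thesis
      unfolding hausdorff_measure_def by (auto intro!: antisym SUP_least)
  qed
  have "hausdorff_dim A \<le> ereal s" if "s > real d" for s
    unfolding hausdorff_dim_def using zero[OF that] that by (intro Inf_lower) auto
  then have "hausdorff_dim A \<le> ereal (real d) + ereal e" if "e > 0" for e
    using that by simp
  then show ?thesis
    unfolding d_def by (rule ereal_le_epsilon2)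
qed

section \<open>Directions with several normal points are null\<close>

text \<open>A ball of radius c around y lies in A; the hypothesis on b is applied at the point of
  this ball farthest in direction b.\<close>

lemma interior_pairing_bound:
  fixes y :: "'a::real_inner"
  assumes "y \<in> interior A"
  obtains c where "c > 0" "\<And>b. (\<And>a. a \<in> A \<Longrightarrow> a \<bullet> b \<le> 0) \<Longrightarrow> c * norm b \<le> - (y \<bullet> b)"
proof -
  obtain e where e: "e > 0" "cball y e \<subseteq> A"
    using assms unfolding mem_interior_cball by auto
  show ?thesis
  proof (rule that[OF e(1)])
    fix b assume b: "\<And>a. a \<in> A \<Longrightarrow> a \<bullet> b \<le> 0"
    show "e * norm b \<le> - (y \<bullet> b)"
    proof (cases "b = 0")
      case False
      have "y + (e / norm b) *\<^sub>R b \<in> A"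
        using e False by (intro subsetD[OF e(2)]) (auto simp: dist_norm)
      from b[OF this] show ?thesis
        using False by (simp add: inner_add_left dot_square_norm power2_eq_square)
    qed simp
  qed
qed

lemma dual_cone_inner_le: "u \<in> dual_cone C \<Longrightarrow> x \<in> C \<Longrightarrow> u \<bullet> x \<le> 0"
  by (simp add: dual_cone_def)

lemma OmegaD: "u \<in> Omega A \<Longrightarrow> norm u = 1" "u \<in> Omega A \<Longrightarrow> u \<in> interior A" "u \<in> Omega A \<Longrightarrow> u \<in> A"
  using interior_subset by (auto simp: Omega_def)

text \<open>This keeps ln (-(u . v)) bounded below on all unit u in the dual cone, so that each
  single direction v has a bounded cost.\<close>

lemma dual_cone_Omega_bound:
  assumes "v \<in> Omega C"
  obtains c where "c > 0" "\<And>u. u \<in> dual_cone C \<Longrightarrow> c * norm u \<le> - (u \<bullet> v)"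
proof -
  obtain c where c: "c > 0" "\<And>b. (\<And>a. a \<in> C \<Longrightarrow> a \<bullet> b \<le> 0) \<Longrightarrow> c * norm b \<le> - (v \<bullet> b)"
    using interior_pairing_bound[OF OmegaD(2)[OF assms]] by blast
  show ?thesis
    using c by (intro that[of c]) (auto simp: dual_cone_def inner_commute)
qed

text \<open>Coercivity: a bound on -(u . x) for one interior direction u bounds x itself. It makes
  the sequences of optimal points bounded.\<close>

lemma Omega_dual_cone_bound:
  assumes "u \<in> Omega (dual_cone C)"
  obtains c where "c > 0" "\<And>x. x \<in> C \<Longrightarrow> c * norm x \<le> - (u \<bullet> x)"
proof -
  obtain c where c: "c > 0" "\<And>b. (\<And>a. a \<in> dual_cone C \<Longrightarrow> a \<bullet> b \<le> 0) \<Longrightarrow> c * norm b \<le> - (u \<bullet> b)"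
    using interior_pairing_bound[OF OmegaD(2)[OF assms]] by blast
  show ?thesis
    using c by (intro that[of c]) (auto simp: dual_cone_inner_le)
qed

lemma Omega_inner_neg:
  assumes "u \<in> Omega (dual_cone C)" "v \<in> C" "v \<noteq> 0"
  shows "u \<bullet> v < 0"
proof -
  obtain c where "c > 0" "\<And>x. x \<in> C \<Longrightarrow> c * norm x \<le> - (u \<bullet> x)"
    using Omega_dual_cone_bound[OF assms(1)] by blast
  then show ?thesis
    using assms by (smt (verit) mult_pos_pos zero_less_norm_iff)
qed

text \<open>Inserting y / norm x splits the difference into (x - y) / norm x and a radial error of
  length abs (norm y - norm x) / norm x; both are at most norm (x - y). It carries estimates from
  the hyperplane of rescaled normals back to unit normals.\<close>

lemma norm_normalize_diff_le:
  fixes x y :: "'a::real_normed_vector"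
  assumes "norm x \<ge> 1" "y \<noteq> 0"
  shows "norm (x /\<^sub>R norm x - y /\<^sub>R norm y) \<le> 2 * norm (x - y)"
proof -
  have x: "norm x > 0" using assms by linarith
  have "x /\<^sub>R norm x - y /\<^sub>R norm y = (x - y) /\<^sub>R norm x + ((norm y - norm x) / (norm x * norm y)) *\<^sub>R y"
    using x assms by (simp add: algebra_simps diff_divide_distrib divide_inverse)
  also have "norm \<dots> \<le> norm (x - y) / norm x + \<bar>norm y - norm x\<bar> / norm x"
  proof (intro order_trans[OF norm_triangle_ineq] add_mono)
    show "norm ((x - y) /\<^sub>R norm x) \<le> norm (x - y) / norm x"
      by (simp add: divide_inverse)
    show "norm (((norm y - norm x) / (norm x * norm y)) *\<^sub>R y) \<le> \<bar>norm y - norm x\<bar> / norm x"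
      using assms by (simp add: abs_mult)
  qed
  also have "\<dots> \<le> norm (x - y) / norm x + norm (x - y) / norm x"
    using norm_triangle_ineq3[of y x] x by (intro add_mono divide_right_mono) (auto simp: norm_minus_commute)
  also have "\<dots> \<le> norm (x - y) + norm (x - y)"
    using assms x by (intro add_mono) (simp_all only: pos_divide_le_eq mult_le_cancel_left1 [of "norm (x - y)"], auto)
  finally show ?thesis by simp
qed

text \<open>Stated for an arbitrary orthonormal basis because the direction v of the rescaling has
  to be one of its elements.\<close>

lemma inner_orthonormal_expansion:
  fixes d z :: "'a::euclidean_space"
  assumes B: "pairwise orthogonal B" "\<And>b. b \<in> B \<Longrightarrow> norm b = 1" "finite B" "span B = UNIV"
  shows "d \<bullet> z = (\<Sum>b\<in>B. (d \<bullet> b) * (z \<bullet> b))" "norm d \<le> (\<Sum>b\<in>B. \<bar>d \<bullet> b\<bar>)"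
proof -
  have d: "d = (\<Sum>b\<in>B. (b \<bullet> d) *\<^sub>R b)" for d :: 'a
  proof (rule vector_eq_dot_span[of _ B])
    show "d \<in> span B" "(\<Sum>b\<in>B. (b \<bullet> d) *\<^sub>R b) \<in> span B" using B by auto
    fix c assume c: "c \<in> B"
    have "c \<bullet> (\<Sum>b\<in>B. (b \<bullet> d) *\<^sub>R b) = (\<Sum>b\<in>B. if b = c then c \<bullet> d else 0)"
      unfolding inner_sum_right using B c
      by (intro sum.cong) (auto simp: pairwise_def orthogonal_def norm_eq_1)
    then show "c \<bullet> d = c \<bullet> (\<Sum>b\<in>B. (b \<bullet> d) *\<^sub>R b)" using c B by simp
  qed
  show "d \<bullet> z = (\<Sum>b\<in>B. (d \<bullet> b) * (z \<bullet> b))"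
    using arg_cong[OF d[of d], of "\<lambda>w. w \<bullet> z"] by (simp add: inner_sum_left inner_commute[of _ d] inner_commute[of z])
  have "norm d \<le> (\<Sum>b\<in>B. norm ((b \<bullet> d) *\<^sub>R b))"
    using d[of d] norm_sum by metis
  also have "\<dots> = (\<Sum>b\<in>B. \<bar>d \<bullet> b\<bar>)"
    using B(2) by (intro sum.cong) (auto simp: inner_commute)
  finally show "norm d \<le> (\<Sum>b\<in>B. \<bar>d \<bullet> b\<bar>)" .
qed

text \<open>A quantitative piece of the set of directions with two normal points: the points are
  bounded by m and separated in coordinate b, across the level \<alpha>, by a gap. The gap yields a
  Lipschitz constant and the non-strict bounds make the piece closed. The bound on u . v controls
  the rescaling of u, and m + 1 avoids a zero denominator.\<close>

definition separated_normals :: "'a::euclidean_space set \<Rightarrow> 'a \<Rightarrow> 'a \<Rightarrow> real \<Rightarrow> nat \<Rightarrow> 'a set" where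
  "separated_normals P v b \<alpha> m =
     {u. norm u = 1 \<and> 1 / (real m + 1) \<le> - (u \<bullet> v) \<and>
         (\<exists>x\<in>P. \<exists>y\<in>P. norm x \<le> m \<and> norm y \<le> m \<and> x \<bullet> b \<le> \<alpha> \<and> \<alpha> + 1 / (real m + 1) \<le> y \<bullet> b \<and>
            (\<forall>z\<in>P. u \<bullet> z \<le> u \<bullet> x \<and> u \<bullet> z \<le> u \<bullet> y))}"

text \<open>The witnesses x and y range over a compact ball, and the projection of a closed set
  along a compact factor is closed.\<close>

lemma closed_separated_normals:
  assumes "closed P"
  shows "closed (separated_normals P v b \<alpha> m)"
proof -
  define T where "T = ((P \<times> P) \<times> UNIV) \<inter> {q :: ('a \<times> 'a) \<times> 'a. fst (fst q) \<bullet> b \<le> \<alpha>}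
    \<inter> {q. \<alpha> + 1 / (real m + 1) \<le> snd (fst q) \<bullet> b}
    \<inter> (\<Inter>z\<in>P. {q. snd q \<bullet> z \<le> snd q \<bullet> fst (fst q)} \<inter> {q. snd q \<bullet> z \<le> snd q \<bullet> snd (fst q)})"
  have "closed T" unfolding T_def using assms
    by (intro closed_Int closed_INT ballI closed_Times closed_UNIV closed_Collect_le continuous_intros)
  then have "closed {u. \<exists>p. p \<in> cball 0 (real m) \<times> cball 0 (real m) \<and> (p, u) \<in> T}"
    by (intro closed_compact_projection compact_Times compact_cball)
  moreover have "closed {u. norm u = 1 \<and> 1 / (real m + 1) \<le> - (u \<bullet> v)}"
    by (intro closed_Collect_conj closed_Collect_le closed_Collect_eq continuous_intros)
  moreover have "separated_normals P v b \<alpha> m = {u. norm u = 1 \<and> 1 / (real m + 1) \<le> - (u \<bullet> v)} \<inter>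
      {u. \<exists>p. p \<in> cball 0 (real m) \<times> cball 0 (real m) \<and> (p, u) \<in> T}"
    unfolding separated_normals_def T_def by (simp add: set_eq_iff) blast
  ultimately show ?thesis by (simp only: closed_Int)
qed

text \<open>
  Normality is scale invariant, so normals may be rescaled into the hyperplane \<open>u \<bullet> v = -1\<close>. There,
  monotonicity of the normal relation makes the set a Lipschitz graph over the
  orthogonal complement of \<open>b\<close> in the hyperplane (Zajicek's argument).
\<close>

lemma hausdorff_dim_separated_normals:
  fixes v b :: "'a::euclidean_space"
  assumes B: "pairwise orthogonal B" "\<And>b. b \<in> B \<Longrightarrow> norm b = 1" "finite B" "span B = UNIV"
    and card: "card B = DIM('a)" and vb: "v \<in> B" "b \<in> B" "v \<noteq> b"
  shows "hausdorff_dim (separated_normals P v b \<alpha> m) \<le> ereal (real DIM('a) - 2)"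
proof -
  define D where "D = B - {v, b}"
  define U where "U u = u /\<^sub>R (- (u \<bullet> v))" for u :: 'a
  let ?E = "separated_normals P v b \<alpha> m"
  have cD: "real (card D) = real DIM('a) - 2"
  proof -
    have "card {v, b} \<le> card B" using vb B by (intro card_mono) auto
    then show ?thesis
      unfolding D_def using vb B card by (subst card_Diff_subset) auto
  qed
  have sumB: "sum g B = g v + g b + sum g D" for g :: "'a \<Rightarrow> real"
  proof -
    have "D = B - {v} - {b}" unfolding D_def by blast
    then show ?thesis
      using vb B sum.remove[of B v g] sum.remove[of "B - {v}" b g] by simp
  qed
  have pos: "- (u \<bullet> v) > 0" if "u \<in> ?E" for u
  proof -
    have "0 < 1 / (real m + 1)" by simp
    also have "1 / (real m + 1) \<le> - (u \<bullet> v)" using that unfolding separated_normals_def by blast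
    finally show ?thesis .
  qed
  have Uv: "U u \<bullet> v = -1" if "u \<in> ?E" for u
    unfolding U_def using pos[OF that] by simp
  \<comment> \<open>Take x on the low side for u and y on the high side for u'. Maximality at x and
    at y gives (U u - U u') . (y - x) at most 0. The v-component of U u - U u' vanishes, y - x has
    b-component at least 1 / (m + 1) and its other components are at most 2m in absolute value;
    division produces the constant.\<close>
  have mono: "((U u - U u') \<bullet> b) \<le> 2 * real m * (real m + 1) * (\<Sum>c\<in>D. \<bar>U u \<bullet> c - U u' \<bullet> c\<bar>)" if E: "u \<in> ?E" "u' \<in> ?E" for u u'
  proof -
    obtain x where x: "x \<in> P" "norm x \<le> m" "x \<bullet> b \<le> \<alpha>" "\<And>z. z \<in> P \<Longrightarrow> u \<bullet> z \<le> u \<bullet> x"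
      using E(1) unfolding separated_normals_def by auto
    obtain y where y: "y \<in> P" "norm y \<le> m" "\<alpha> + 1 / (real m + 1) \<le> y \<bullet> b" "\<And>z. z \<in> P \<Longrightarrow> u' \<bullet> z \<le> u' \<bullet> y"
      using E(2) unfolding separated_normals_def by auto
    define d where "d = U u - U u'"
    define z where "z = y - x"
    define S where "S = (\<Sum>c\<in>D. \<bar>U u \<bullet> c - U u' \<bullet> c\<bar>)"
    have nz: "norm z \<le> 2 * m"
      unfolding z_def using x y norm_triangle_ineq4[of y x] by linarith
    have zb: "1 / (real m + 1) \<le> z \<bullet> b"
      unfolding z_def using x y by (simp add: inner_diff_left)
    have "U u \<bullet> z \<le> 0"
      unfolding U_def z_def using x(4)[OF y(1)] pos[OF E(1)]
      by (simp add: inner_diff_right divide_le_0_iff mult_le_0_iff)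
    moreover have "U u' \<bullet> z \<ge> 0"
      unfolding U_def z_def using y(4)[OF x(1)] pos[OF E(2)]
      by (simp add: inner_diff_right mult_nonneg_nonneg)
    ultimately have "d \<bullet> z \<le> 0"
      unfolding d_def by (simp add: inner_diff_left)
    moreover have "d \<bullet> z = (d \<bullet> v) * (z \<bullet> v) + (d \<bullet> b) * (z \<bullet> b) + (\<Sum>c\<in>D. (d \<bullet> c) * (z \<bullet> c))"
      using inner_orthonormal_expansion(1)[OF B, where d=d and z=z] sumB[of "\<lambda>c. (d \<bullet> c) * (z \<bullet> c)"] by simp
    moreover have "d \<bullet> v = 0"
      unfolding d_def using Uv E by (simp add: inner_diff_left)
    ultimately have "(d \<bullet> b) * (z \<bullet> b) \<le> - (\<Sum>c\<in>D. (d \<bullet> c) * (z \<bullet> c))" by simp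
    also have "\<dots> \<le> (\<Sum>c\<in>D. \<bar>(d \<bullet> c) * (z \<bullet> c)\<bar>)"
      using sum_abs[of "\<lambda>c. (d \<bullet> c) * (z \<bullet> c)" D] by linarith
    also have "\<dots> \<le> (\<Sum>c\<in>D. \<bar>d \<bullet> c\<bar> * (2 * m))"
    proof (rule sum_mono)
      fix c assume "c \<in> D"
      then have "\<bar>z \<bullet> c\<bar> \<le> 2 * m"
        using Cauchy_Schwarz_ineq2[of z c] B(2)[of c] nz by (simp add: D_def)
      then show "\<bar>(d \<bullet> c) * (z \<bullet> c)\<bar> \<le> \<bar>d \<bullet> c\<bar> * (2 * m)"
        by (simp add: abs_mult mult_left_mono)
    qed
    also have "\<dots> = 2 * m * S"
      unfolding S_def d_def by (simp add: sum_distrib_left inner_diff_left mult.commute)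
    finally have le: "(d \<bullet> b) * (z \<bullet> b) \<le> 2 * m * S" .
    have S0: "S \<ge> 0" unfolding S_def by (intro sum_nonneg) auto
    have "d \<bullet> b \<le> 2 * real m * (real m + 1) * S"
    proof (cases "d \<bullet> b \<ge> 0")
      case True
      then have "(d \<bullet> b) * (1 / (real m + 1)) \<le> 2 * m * S"
        using zb le by (meson mult_left_mono order_trans)
      then show ?thesis by (simp add: field_simps)
    next
      case False
      moreover have "0 \<le> 2 * real m * (real m + 1) * S" using S0 by simp
      ultimately show ?thesis by linarith
    qed
    then show ?thesis unfolding d_def S_def .
  qed
  have "hausdorff_dim ?E \<le> ereal (real (card D))"
  \<comment> \<open>In M the outer 2 comes from normalising, 2m(m + 1) from the b-coordinate and 1
    from the coordinates in D. R bounds the rescaling factor 1 / (-(u . v)).\<close>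
  proof (rule hausdorff_dim_le_card_coordinates[where f = "\<lambda>u c. U u \<bullet> c" and R = "m + 1" and M = "2 * (2 * real m * (real m + 1) + 1)"])
    show "finite D" using B by (simp add: D_def)
  next
    fix u c assume u: "u \<in> ?E" "c \<in> D"
    have u1: "norm u = 1" "1 / (real m + 1) \<le> - (u \<bullet> v)" using u by (auto simp: separated_normals_def)
    have "\<bar>u \<bullet> c\<bar> \<le> 1"
      using Cauchy_Schwarz_ineq2[of u c] u1 B(2)[of c] u by (simp add: D_def)
    moreover have "inverse (- (u \<bullet> v)) \<le> m + 1"
      using u1 pos[OF u(1)] by (simp add: field_simps)
    ultimately have "inverse (- (u \<bullet> v)) * \<bar>u \<bullet> c\<bar> \<le> real (m + 1) * 1"
      using pos[OF u(1)] by (intro mult_mono) auto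
    then show "\<bar>U u \<bullet> c\<bar> \<le> real (m + 1)"
      unfolding U_def using pos[OF u(1)] by (simp add: abs_mult)
  next
    fix u u' assume E: "u \<in> ?E" "u' \<in> ?E"
    define S where "S = (\<Sum>c\<in>D. \<bar>U u \<bullet> c - U u' \<bullet> c\<bar>)"
    have n: "U u /\<^sub>R norm (U u) = u" "norm (U u) \<ge> 1" "U u \<noteq> 0" if "u \<in> ?E" for u
    proof -
      have u1: "norm u = 1" using that by (auto simp: separated_normals_def)
      have nU: "norm (U u) = inverse (- (u \<bullet> v))"
        unfolding U_def using u1 pos[OF that] by simp
      show "U u /\<^sub>R norm (U u) = u" unfolding nU using pos[OF that] by (simp add: U_def)
      have "- (u \<bullet> v) \<le> 1"
        using Cauchy_Schwarz_ineq2[of u v] u1 B(2)[OF vb(1)] by simp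
      then show "norm (U u) \<ge> 1" unfolding nU using pos[OF that] by (intro one_le_inverse) auto
      then show "U u \<noteq> 0" by auto
    qed
    have "dist u u' \<le> 2 * norm (U u - U u')"
      using norm_normalize_diff_le[of "U u" "U u'"] n E by (simp add: dist_norm)
    also have "norm (U u - U u') \<le> (\<Sum>c\<in>B. \<bar>(U u - U u') \<bullet> c\<bar>)"
      by (rule inner_orthonormal_expansion(2)[OF B])
    also have "\<dots> = \<bar>(U u - U u') \<bullet> b\<bar> + S"
      unfolding sumB S_def using Uv E by (simp add: inner_diff_left)
    also have "\<bar>(U u - U u') \<bullet> b\<bar> \<le> 2 * real m * (real m + 1) * S"
    proof -
      have "S = (\<Sum>c\<in>D. \<bar>U u' \<bullet> c - U u \<bullet> c\<bar>)" unfolding S_def by (simp add: abs_minus_commute)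
      then show ?thesis
        using mono[OF E] mono[OF E(2,1)] unfolding S_def by (simp add: inner_diff_left abs_le_iff)
    qed
    finally show "dist u u' \<le> (2 * (2 * real m * (real m + 1) + 1)) * (\<Sum>c\<in>D. \<bar>U u \<bullet> c - U u' \<bullet> c\<bar>)"
      unfolding S_def by (simp add: algebra_simps)
  qed simp
  then show ?thesis using cD by simp
qed

text \<open>The exceptional directions are a countable union of closed pieces of dimension at most n
  - 2, indexed by a separating coordinate, a rational level and a size m. P is any closed set, so
  that the lemma serves both two-point sets (ties) and the limit pseudo-cone.\<close>

lemma null_sets_multiple_normals:
  fixes C P :: "'a::euclidean_space set"
  assumes sets: "sets \<mu> = sets (restrict_space borel (Omega (dual_cone C)))"
    and null: "\<And>A. A \<in> sets \<mu> \<Longrightarrow> hausdorff_dim A \<le> ereal (real DIM('a) - 2) \<Longrightarrow> emeasure \<mu> A = 0"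
    and v: "v \<in> Omega C" and P: "closed P"
  shows "{u \<in> Omega (dual_cone C). \<exists>x y. x \<noteq> y \<and> normal_vector P x u \<and> normal_vector P y u} \<in> null_sets \<mu>"
proof -
  let ?W = "Omega (dual_cone C)"
  obtain B where B: "v \<in> B" "pairwise orthogonal B" "\<And>x. x \<in> B \<Longrightarrow> norm x = 1"
    "independent B" "card B = DIM('a)" "span B = UNIV"
    using vector_in_orthonormal_basis[OF OmegaD(1)[OF v]] by metis
  have fB: "finite B" using B(4) by (rule independent_imp_finite)
  have dim_mono: "hausdorff_dim A \<le> hausdorff_dim A'" if "A \<subseteq> A'" for A A' :: "'a set"
  proof -
    have "hausdorff_measure s A \<le> hausdorff_measure s A'" for s
      unfolding hausdorff_measure_def hausdorff_premeasure_def using that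
      by (intro SUP_mono' INF_superset_mono) auto
    then show ?thesis
      unfolding hausdorff_dim_def by (intro Inf_superset_mono) (auto, metis le_zero_eq)
  qed
  have piece: "separated_normals P v b \<alpha> m \<inter> ?W \<in> null_sets \<mu>" if "b \<in> B - {v}" for b \<alpha> m
  proof -
    have m: "separated_normals P v b \<alpha> m \<inter> ?W \<in> sets \<mu>"
      unfolding sets sets_restrict_space
      using closed_separated_normals[OF P] by (auto intro!: image_eqI[of _ _ "separated_normals P v b \<alpha> m"])
    have "hausdorff_dim (separated_normals P v b \<alpha> m \<inter> ?W) \<le> hausdorff_dim (separated_normals P v b \<alpha> m)"
      by (rule dim_mono) simp
    also have "\<dots> \<le> ereal (real DIM('a) - 2)"
      using that by (intro hausdorff_dim_separated_normals[OF B(2,3) fB B(6,5)]) (auto simp: B)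
    finally show ?thesis using null[OF m] m by auto
  qed
  have "{u \<in> ?W. \<exists>x y. x \<noteq> y \<and> normal_vector P x u \<and> normal_vector P y u}
      = (\<Union>b\<in>B - {v}. \<Union>\<alpha>\<in>\<rat>. \<Union>m. separated_normals P v b \<alpha> m \<inter> ?W)" (is "?L = ?R")
  proof
    show "?R \<subseteq> ?L"
    proof
      fix u assume "u \<in> ?R"
      then obtain b \<alpha> m where u: "u \<in> ?W" "u \<in> separated_normals P v b \<alpha> m" by blast
      then obtain x y where xy: "x \<in> P" "y \<in> P" "x \<bullet> b \<le> \<alpha>" "\<alpha> + 1 / (real m + 1) \<le> y \<bullet> b"
        "\<forall>z\<in>P. u \<bullet> z \<le> u \<bullet> x \<and> u \<bullet> z \<le> u \<bullet> y" "norm u = 1"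
        unfolding separated_normals_def by blast
      have "0 < 1 / (real m + 1)" by simp
      then have "x \<bullet> b < y \<bullet> b" using xy(3,4) by linarith
      then have "x \<noteq> y" by auto
      then show "u \<in> ?L" using u xy by (auto simp: normal_vector_def)
    qed
    show "?L \<subseteq> ?R"
    proof
      fix u assume "u \<in> ?L"
      then obtain x y where u: "u \<in> ?W" and xy: "x \<noteq> y" "normal_vector P x u" "normal_vector P y u" by auto
      have uv: "u \<bullet> v < 0"
        using Omega_inner_neg[OF u, of v] OmegaD[OF v] by force
      have uxy: "u \<bullet> (x - y) = 0"
        using xy by (auto simp: normal_vector_def inner_diff_right intro: antisym)
      \<comment> \<open>The difference x - y is orthogonal to u and u is not orthogonal to v, so x -
        y is not a multiple of v: some coordinate other than v tells x and y apart.\<close>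
      have "\<exists>b\<in>B - {v}. (x - y) \<bullet> b \<noteq> 0"
      proof (rule ccontr)
        assume "\<not> ?thesis"
        then have z: "(x - y) \<bullet> b = 0" if "b \<in> B" "b \<noteq> v" for b using that by auto
        have "u \<bullet> (x - y) = (u \<bullet> v) * ((x - y) \<bullet> v)"
          using inner_orthonormal_expansion(1)[OF B(2,3) fB B(6), where d=u and z="x - y"]
            sum.remove[OF fB B(1), of "\<lambda>b. (u \<bullet> b) * ((x - y) \<bullet> b)"] z by (simp add: sum.neutral)
        then have "(x - y) \<bullet> v = 0" using uxy uv by simp
        then have "norm (x - y) \<le> 0"
          using inner_orthonormal_expansion(2)[OF B(2,3) fB B(6), of "x - y"] z
          by (metis (no_types, lifting) abs_zero sum.neutral)
        with xy show False by simp
      qed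
      then obtain b where b: "b \<in> B - {v}" "x \<bullet> b \<noteq> y \<bullet> b" by (auto simp: inner_diff_left)
      have *: "u \<in> ?R" if xy: "x \<bullet> b < y \<bullet> b" "normal_vector P x u" "normal_vector P y u" for x y
      proof -
        obtain q where q: "x \<bullet> b < of_rat q" "of_rat q < y \<bullet> b" using of_rat_dense[OF xy(1)] by blast
        have "\<forall>\<^sub>F m in sequentially. 1 / (real m + 1) \<le> y \<bullet> b - of_rat q \<and> 1 / (real m + 1) \<le> - (u \<bullet> v)"
        proof -
          have "(\<lambda>m. 1 / (real m + 1)) \<longlonglongrightarrow> 0"
            using LIMSEQ_inverse_real_of_nat by (simp add: inverse_eq_divide add.commute)
          from order_tendstoD(2)[OF this, of "min (y \<bullet> b - of_rat q) (- (u \<bullet> v))"]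
          show ?thesis using q uv by (auto elim: eventually_mono)
        qed
        moreover have "\<forall>\<^sub>F m in sequentially. norm x \<le> real m" "\<forall>\<^sub>F m in sequentially. norm y \<le> real m"
          using filterlim_real_sequentially by (auto simp: filterlim_at_top)
        ultimately have "\<forall>\<^sub>F m in sequentially. u \<in> separated_normals P v b (of_rat q) m"
        proof eventually_elim
          case (elim m)
          then show ?case
            using xy q OmegaD(1)[OF u] unfolding separated_normals_def normal_vector_def
            by (intro CollectI conjI bexI[of _ x] bexI[of _ y]) auto
        qed
        then obtain m where m: "u \<in> separated_normals P v b (of_rat q) m"
          using eventually_happens' sequentially_bot by blast
        show ?thesis using b(1) u m
          by (intro UN_I[of b] UN_I[of "of_rat q :: real"] UN_I[of m]) auto
      qed
      show "u \<in> ?R"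
        using *[OF _ xy(2,3)] *[OF _ xy(3,2)] b(2) by (cases "x \<bullet> b < y \<bullet> b") auto
    qed
  qed
  also have "\<dots> \<in> null_sets \<mu>"
    by (intro null_sets_UN' piece countable_finite countable_rat null_sets_UN finite_Diff fB)
  finally show ?thesis .
qed

section \<open>The semi-discrete problem\<close>

text \<open>
  Maximising the concave functional \<open>\<lambda>t. (\<integral>x. (MIN i. t i + c i x)) - (\<Sum>i. w i * t i)\<close>; raising one
  coordinate of a maximiser bounds the measure of its cell by its weight.
\<close>

lemma semi_discrete_potentials:
  fixes c :: "nat \<Rightarrow> 'a \<Rightarrow> real" and w :: "nat \<Rightarrow> real"
  assumes "prob_space M" and n: "n > 0"
    and c [measurable]: "\<And>i. i < n \<Longrightarrow> c i \<in> borel_measurable M"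
    and B: "B \<ge> 0" "\<And>i x. i < n \<Longrightarrow> x \<in> space M \<Longrightarrow> \<bar>c i x\<bar> \<le> B"
    and w: "\<And>i. i < n \<Longrightarrow> w i > 0" "(\<Sum>i<n. w i) = 1"
    and ties: "\<And>i j a. i < n \<Longrightarrow> j < n \<Longrightarrow> i \<noteq> j \<Longrightarrow> AE x in M. a + c i x \<noteq> c j x"
  obtains t where "\<And>i. i < n \<Longrightarrow> measure M {x \<in> space M. \<forall>j<n. t i + c i x \<le> t j + c j x} = w i"
proof -
  interpret prob_space M by fact
  define m where "m t x = Min ((\<lambda>i. t i + c i x) ` {..<n})" for t x
  define F where "F t = (\<integral>x. m t x \<partial>M) - (\<Sum>i<n. w i * t i)" for t
  have ne: "(\<lambda>i. t i + c i x) ` {..<n} \<noteq> {}" for t x using n by auto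
  have m_le: "m t x \<le> t i + c i x" if "i < n" for t x i
    unfolding m_def using that by (intro Min_le) auto
  have m_ge: "b \<le> m t x" if "\<And>i. i < n \<Longrightarrow> b \<le> t i + c i x" for t x b
    unfolding m_def using that ne by (subst Min_ge_iff) auto
  have m_meas [measurable]: "m t \<in> borel_measurable M" for t
    unfolding m_def by (intro borel_measurable_Min) auto
  have m_diff: "m t x \<le> m s x + (\<Sum>i<n. \<bar>t i - s i\<bar>)" for t s x
  proof -
    have "m t x - (\<Sum>i<n. \<bar>t i - s i\<bar>) \<le> m s x"
    proof (rule m_ge)
      fix i assume i: "i < n"
      have "\<bar>t i - s i\<bar> \<le> (\<Sum>i<n. \<bar>t i - s i\<bar>)"
        using i by (intro member_le_sum) auto
      then show "m t x - (\<Sum>i<n. \<bar>t i - s i\<bar>) \<le> s i + c i x"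
        using m_le[OF i, of t x] by linarith
    qed
    then show ?thesis by simp
  qed
  have m_0: "\<bar>m (\<lambda>_. 0) x\<bar> \<le> B" if "x \<in> space M" for x
  proof -
    have "- B \<le> m (\<lambda>_. 0) x" using B(2)[OF _ that] by (intro m_ge) (smt (verit))
    moreover have "m (\<lambda>_. 0) x \<le> B"
      using B(2)[OF n that] m_le[OF n, of "\<lambda>_. 0" x] by linarith
    ultimately show ?thesis by simp
  qed
  have m_int: "integrable M (m t)" for t
  proof (rule integrable_const_bound)
    show "AE x in M. norm (m t x) \<le> B + (\<Sum>i<n. \<bar>t i\<bar>)"
    proof (rule AE_I2)
      fix x assume x: "x \<in> space M"
      show "norm (m t x) \<le> B + (\<Sum>i<n. \<bar>t i\<bar>)"
        using m_0[OF x] m_diff[of t x "\<lambda>_. 0"] m_diff[of "\<lambda>_. 0" x t] by simp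
    qed
  qed simp
  have w1: "w i \<le> 1" if "i < n" for i
    unfolding w(2)[symmetric] using w(1) that by (intro member_le_sum) (auto intro: less_imp_le)
  have F_diff: "F t - F s \<le> 2 * (\<Sum>i<n. \<bar>t i - s i\<bar>)" for t s
  proof -
    have "(\<integral>x. m t x \<partial>M) \<le> (\<integral>x. m s x + (\<Sum>i<n. \<bar>t i - s i\<bar>) \<partial>M)"
      using m_diff by (intro integral_mono Bochner_Integration.integrable_add m_int integrable_const)
    also have "\<dots> = (\<integral>x. m s x \<partial>M) + (\<Sum>i<n. \<bar>t i - s i\<bar>)"
      using m_int by (simp add: prob_space)
    finally have 1: "(\<integral>x. m t x \<partial>M) \<le> (\<integral>x. m s x \<partial>M) + (\<Sum>i<n. \<bar>t i - s i\<bar>)" .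
    have "(\<Sum>i<n. w i * s i) - (\<Sum>i<n. w i * t i) \<le> (\<Sum>i<n. \<bar>t i - s i\<bar>)"
      unfolding sum_subtractf[symmetric]
    proof (rule sum_mono)
      fix i assume i: "i \<in> {..<n}"
      have "w i * s i - w i * t i \<le> w i * \<bar>t i - s i\<bar>"
        unfolding right_diff_distrib[symmetric] using w(1)[of i] i by (intro mult_left_mono) auto
      also have "\<dots> \<le> 1 * \<bar>t i - s i\<bar>"
        using w1[of i] i by (intro mult_right_mono) auto
      finally show "w i * s i - w i * t i \<le> \<bar>t i - s i\<bar>" by simp
    qed
    with 1 show ?thesis unfolding F_def by linarith
  qed
  have F_cont: "continuous_on S F" for S
    unfolding continuous_on_def
  proof
    fix s assume "s \<in> S"
    have cont: "continuous_on UNIV (\<lambda>t :: nat \<Rightarrow> real. 2 * (\<Sum>i<n. \<bar>t i - s i\<bar>))"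
      by (intro continuous_intros continuous_on_product_coordinates)
    then have "((\<lambda>t. 2 * (\<Sum>i<n. \<bar>t i - s i\<bar>)) \<longlongrightarrow> 2 * (\<Sum>i<n. \<bar>s i - s i\<bar>)) (at s within S)"
      using continuous_on_subset[OF cont, of S] \<open>s \<in> S\<close> unfolding continuous_on_def by blast
    then have "((\<lambda>t. F t - F s) \<longlongrightarrow> 0) (at s within S)"
    proof (rule Lim_null_comparison[rotated, OF tendsto_eq_rhs])
      show "\<forall>\<^sub>F t in at s within S. norm (F t - F s) \<le> 2 * (\<Sum>i<n. \<bar>t i - s i\<bar>)"
      proof (rule always_eventually, rule allI)
        fix t show "norm (F t - F s) \<le> 2 * (\<Sum>i<n. \<bar>t i - s i\<bar>)"
          using F_diff[of t s] F_diff[of s t] by (simp add: abs_minus_commute abs_le_iff)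
      qed
    qed simp
    then show "(F \<longlongrightarrow> F s) (at s within S)" by (rule LIM_zero_cancel)
  qed
  define wmin where "wmin = Min (w ` {..<n})"
  have wmin: "wmin > 0" "\<And>i. i < n \<Longrightarrow> wmin \<le> w i"
    unfolding wmin_def using w n by (subst Min_gr_iff, auto)
  \<comment> \<open>After a shift making the smallest coordinate 0, the integral part of F is at
    most B. A coordinate above T makes the linear part at least wmin * T = 2B, hence F at most -B,
    which is no better than F at 0.\<close>
  define T where "T = 2 * B / wmin"
  have T: "T \<ge> 0" unfolding T_def using B wmin by simp
  \<comment> \<open>F is invariant under adding a constant to the first n coordinates, since the
    weights sum to 1; so the maximum over this compact box is global. The coordinates from n on do
    not enter F and are frozen at 0.\<close>
  define X where "X = {t :: nat \<Rightarrow> real. \<forall>i. 0 \<le> t i \<and> t i \<le> (if i < n then T else 0)}"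
  have X0: "(\<lambda>_. 0) \<in> X" using T by (auto simp: X_def)
  have "compact X" unfolding X_def by (rule compact_fun_box)
  then obtain t where t: "t \<in> X" "\<And>s. s \<in> X \<Longrightarrow> F s \<le> F t"
    using continuous_attains_sup[OF _ _ F_cont, of X] X0 by blast
  have tmax: "F s \<le> F t" for s
  proof -
    define k where "k = Min (s ` {..<n})"
    define s' where "s' = (\<lambda>i. if i < n then s i - k else 0)"
    have k: "k \<le> s i" if "i < n" for i unfolding k_def using that by (intro Min_le) auto
    have "k \<in> s ` {..<n}" unfolding k_def using n by (intro Min_in) auto
    then obtain i0 where i0: "i0 < n" "s' i0 = 0" by (auto simp: s'_def)
    have m': "m s' x = m s x - k" for x
    proof (rule antisym)
      have "m s' x + k \<le> m s x"
      proof (rule m_ge)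
        fix i assume "i < n"
        then show "m s' x + k \<le> s i + c i x" using m_le[of i s' x] by (simp add: s'_def)
      qed
      then show "m s' x \<le> m s x - k" by simp
      show "m s x - k \<le> m s' x"
      proof (rule m_ge)
        fix i assume "i < n"
        then show "m s x - k \<le> s' i + c i x" using m_le[of i s x] by (simp add: s'_def)
      qed
    qed
    have "(\<Sum>i<n. w i * s' i) = (\<Sum>i<n. w i * s i) - k * (\<Sum>i<n. w i)"
      unfolding s'_def sum_distrib_left sum_subtractf[symmetric]
      by (intro sum.cong) (auto simp: algebra_simps)
    then have F': "F s' = F s"
      unfolding F_def m' using m_int w(2) by (simp add: prob_space)
    have s'0: "s' i \<ge> 0" for i using k by (auto simp: s'_def)
    show ?thesis
    proof (cases "\<forall>i<n. s' i \<le> T")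
      case True
      then have "s' \<in> X" using s'0 by (auto simp: X_def) (auto simp: s'_def)
      then show ?thesis using t(2) F' by metis
    next
      case False
      then obtain i where i: "i < n" "s' i > T" by auto
      have "2 * B = wmin * T" unfolding T_def using wmin by simp
      also have "\<dots> \<le> w i * s' i" using wmin i T w(1)[OF i(1)] by (intro mult_mono) auto
      also have "\<dots> \<le> (\<Sum>i<n. w i * s' i)"
        using i s'0 by (intro member_le_sum) (auto intro!: mult_nonneg_nonneg less_imp_le[OF w(1)])
      finally have 1: "2 * B \<le> (\<Sum>i<n. w i * s' i)" .
      have "(\<integral>x. m s' x \<partial>M) \<le> (\<integral>x. B \<partial>M)"
      proof (intro integral_mono m_int integrable_const)
        fix x assume "x \<in> space M"
        then show "m s' x \<le> B" using m_le[OF i0(1), of s' x] B(2)[OF i0(1)] i0(2) by fastforce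
      qed
      then have "F s' \<le> - B" unfolding F_def using 1 by (simp add: prob_space)
      also have "- B \<le> F (\<lambda>_. 0)"
      proof -
        have "(\<integral>x. - B \<partial>M) \<le> (\<integral>x. m (\<lambda>_. 0) x \<partial>M)"
          using m_0 by (intro integral_mono m_int integrable_const) (smt (verit))
        then show ?thesis unfolding F_def by (simp add: prob_space)
      qed
      also have "\<dots> \<le> F t" using t(2) X0 by blast
      finally show ?thesis using F' by simp
    qed
  qed
  define Z where "Z i = {x \<in> space M. \<forall>j<n. j \<noteq> i \<longrightarrow> t i + c i x < t j + c j x}" for i
  have Z_meas [measurable]: "Z i \<in> sets M" if "i < n" for i
    unfolding Z_def using that by measurable
  have Z_le: "measure M (Z i) \<le> w i" if i: "i < n" for i
  proof -
    \<comment> \<open>On \<open>G k\<close> index i wins by at least 1 / (k + 1), so raising t i by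
      that amount raises the minimum by all of it there and lowers it nowhere; maximality then
      bounds the measure of \<open>G k\<close> by w i. The strict cell \<open>Z i\<close> is the
      increasing union of these sets.\<close>
    define G where "G k = {x \<in> space M. \<forall>j<n. j \<noteq> i \<longrightarrow> t i + c i x + 1 / (real k + 1) \<le> t j + c j x}" for k :: nat
    have G_meas [measurable]: "G k \<in> sets M" for k unfolding G_def using i by measurable
    have G_le: "measure M (G k) \<le> w i" for k
    proof -
      define e where "e = 1 / (real k + 1)"
      have e: "e > 0" by (simp add: e_def)
      define s where "s = t(i := t i + e)"
      have "m t x + e * indicator (G k) x \<le> m s x" for x
      proof (rule m_ge)
        fix j assume j: "j < n"
        show "m t x + e * indicator (G k) x \<le> s j + c j x"
        proof (cases "j = i")
          case True
          then show ?thesis using e m_le[OF i, of t x] by (auto simp: s_def indicator_def)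
        next
          case False
          then show ?thesis using e j m_le[OF i, of t x] m_le[OF j, of t x]
            by (auto simp: s_def indicator_def G_def e_def)
        qed
      qed
      then have "(\<integral>x. m t x + e * indicator (G k) x \<partial>M) \<le> (\<integral>x. m s x \<partial>M)"
        by (intro integral_mono Bochner_Integration.integrable_add m_int integrable_mult_right integrable_real_indicator)
           (auto simp: emeasure_eq_measure)
      moreover have "(\<integral>x. m t x + e * indicator (G k) x \<partial>M) = (\<integral>x. m t x \<partial>M) + e * measure M (G k)"
        using m_int by (subst Bochner_Integration.integral_add) (auto simp: emeasure_eq_measure)
      moreover have "(\<Sum>j<n. w j * s j) = (\<Sum>j<n. w j * t j) + w i * e"
      proof -
        have "(\<Sum>j<n. w j * s j) = (\<Sum>j<n. w j * t j + (if j = i then w i * e else 0))"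
          unfolding s_def by (intro sum.cong) (auto simp: algebra_simps)
        then show ?thesis using i by (simp add: sum.distrib)
      qed
      ultimately have "F t + e * measure M (G k) - w i * e \<le> F s" unfolding F_def by simp
      then have "e * measure M (G k) \<le> e * w i" using tmax[of s] by (simp add: mult.commute)
      then show ?thesis using e by simp
    qed
    have "incseq G"
    proof (rule incseq_SucI)
      fix k
      have "1 / (real (Suc k) + 1) \<le> 1 / (real k + 1)" by (intro divide_left_mono) auto
      then show "G k \<subseteq> G (Suc k)" unfolding G_def by (fastforce intro: order_trans[rotated])
    qed
    moreover have "(\<Union>k. G k) = Z i"
    proof
      show "(\<Union>k. G k) \<subseteq> Z i"
      proof
        fix x assume "x \<in> (\<Union>k. G k)"
        then obtain k where k: "x \<in> G k" by blast
        have "0 < 1 / (real k + 1)" by simp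
        have "t i + c i x < t j + c j x" if "j < n" "j \<noteq> i" for j
        proof -
          have "t i + c i x + 1 / (real k + 1) \<le> t j + c j x" using k that unfolding G_def by blast
          then show ?thesis using \<open>0 < 1 / (real k + 1)\<close> by linarith
        qed
        then show "x \<in> Z i" using k unfolding G_def Z_def by blast
      qed
      show "Z i \<subseteq> (\<Union>k. G k)"
      proof
        fix x assume x: "x \<in> Z i"
        have "\<forall>\<^sub>F k in sequentially. \<forall>j\<in>{..<n}. j \<noteq> i \<longrightarrow> t i + c i x + 1 / (real k + 1) \<le> t j + c j x"
        proof (intro eventually_ball_finite ballI)
          fix j assume j: "j \<in> {..<n}"
          show "\<forall>\<^sub>F k in sequentially. j \<noteq> i \<longrightarrow> t i + c i x + 1 / (real k + 1) \<le> t j + c j x"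
          proof (cases "j = i")
            case False
            then have "t j + c j x - (t i + c i x) > 0" using x j by (auto simp: Z_def)
            moreover have "(\<lambda>k. 1 / (real k + 1)) \<longlonglongrightarrow> 0"
              using LIMSEQ_inverse_real_of_nat by (simp add: inverse_eq_divide add.commute)
            ultimately have "\<forall>\<^sub>F k in sequentially. 1 / (real k + 1) < t j + c j x - (t i + c i x)"
              by (rule order_tendstoD(2)[rotated])
            then show ?thesis by eventually_elim linarith
          qed simp
        qed simp
        then obtain k where "\<forall>j\<in>{..<n}. j \<noteq> i \<longrightarrow> t i + c i x + 1 / (real k + 1) \<le> t j + c j x"
          using eventually_happens' sequentially_bot by blast
        then show "x \<in> (\<Union>k. G k)" using x unfolding G_def Z_def by auto
      qed
    qed
    ultimately have "(\<lambda>k. measure M (G k)) \<longlonglongrightarrow> measure M (Z i)"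
      using finite_Lim_measure_incseq[of G] G_meas by (simp add: image_subset_iff)
    then show ?thesis using G_le by (intro LIMSEQ_le_const2) auto
  qed
  have AE_ties: "AE x in M. \<forall>i<n. \<forall>j<n. i \<noteq> j \<longrightarrow> t i + c i x \<noteq> t j + c j x"
  proof -
    have "AE x in M. \<forall>i\<in>{..<n}. \<forall>j\<in>{..<n}. i \<noteq> j \<longrightarrow> t i + c i x \<noteq> t j + c j x"
    proof (intro AE_finite_allI finite_lessThan)
      fix i j assume ij: "i \<in> {..<n}" "j \<in> {..<n}"
      show "AE x in M. i \<noteq> j \<longrightarrow> t i + c i x \<noteq> t j + c j x"
      proof (cases "i = j")
        case False
        then have "AE x in M. t i - t j + c i x \<noteq> c j x" using ties ij by auto
        then show ?thesis by eventually_elim auto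
      qed simp
    qed
    then show ?thesis by eventually_elim auto
  qed
  \<comment> \<open>Without ties the strict cells cover almost everything, so their measures sum to
    at least 1, the sum of the weights. Together with the bounds cell by cell this forces equality
    in each.\<close>
  have ge: "1 \<le> (\<Sum>i<n. measure M (Z i))"
  proof -
    have "AE x in M. x \<in> (\<Union>i<n. Z i)"
      using AE_ties AE_space
    proof eventually_elim
      case (elim x)
      obtain i where i: "i < n" "m t x = t i + c i x"
        using Min_in[OF _ ne, of t x] unfolding m_def by auto
      have "t i + c i x < t j + c j x" if "j < n" "j \<noteq> i" for j
        using m_le[OF that(1), of t x] i elim that by (metis order_le_less)
      then show ?case using i(1) elim by (auto simp: Z_def)
    qed
    then have "1 = measure M (\<Union>i<n. Z i)"
      by (subst (asm) prob_eq_1[symmetric]) auto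
    also have "\<dots> \<le> (\<Sum>i<n. measure M (Z i))"
      by (intro finite_measure_subadditive_finite) auto
    finally show ?thesis .
  qed
  have Z_eq: "measure M (Z i) = w i" if "i < n" for i
  proof -
    have "(\<Sum>j<n. measure M (Z j)) = (\<Sum>j<n. w j)"
    proof (rule antisym)
      show "(\<Sum>j<n. measure M (Z j)) \<le> (\<Sum>j<n. w j)" using Z_le by (intro sum_mono) auto
      show "(\<Sum>j<n. w j) \<le> (\<Sum>j<n. measure M (Z j))" using ge w(2) by simp
    qed
    then show ?thesis using sum_mono_inv[of "\<lambda>j. measure M (Z j)" "{..<n}" w i] Z_le that by auto
  qed
  show ?thesis
  proof (rule that)
    fix i assume i: "i < n"
    have "measure M {x \<in> space M. \<forall>j<n. t i + c i x \<le> t j + c j x} = measure M (Z i)"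
    proof (rule finite_measure_eq_AE)
      show "AE x in M. (x \<in> {x \<in> space M. \<forall>j<n. t i + c i x \<le> t j + c j x}) = (x \<in> Z i)"
        using AE_ties
      proof eventually_elim
        case (elim x)
        have "(\<forall>j<n. t i + c i x \<le> t j + c j x) \<longleftrightarrow> (\<forall>j<n. j \<noteq> i \<longrightarrow> t i + c i x < t j + c j x)"
          using elim i by (metis order_le_less)
        then show ?case unfolding Z_def by blast
      qed
      show "{x \<in> space M. \<forall>j<n. t i + c i x \<le> t j + c j x} \<in> sets M" "Z i \<in> sets M"
        using i by measurable
    qed
    then show "measure M {x \<in> space M. \<forall>j<n. t i + c i x \<le> t j + c j x} = w i"
      using Z_eq i by simp
  qed
qed

text \<open>With r_i = exp (t_i), minimising t_i + ln (-(u . v_i)) is maximising u . (r_i v_i), so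
  the cells of the potentials are the sets of directions that select the point r_i v_i.\<close>

lemma semi_discrete_reverse_gauss:
  fixes C :: "'a::euclidean_space set" and v :: "nat \<Rightarrow> 'a"
  assumes "prob_space \<mu>" and sets: "sets \<mu> = sets (restrict_space borel (Omega (dual_cone C)))"
    and null: "\<And>A. A \<in> sets \<mu> \<Longrightarrow> hausdorff_dim A \<le> ereal (real DIM('a) - 2) \<Longrightarrow> emeasure \<mu> A = 0"
    and n: "n > 0" and v: "\<And>i. i < n \<Longrightarrow> v i \<in> Omega C" "inj_on v {..<n}"
    and w: "\<And>i. i < n \<Longrightarrow> w i > 0" "(\<Sum>i<n. w i) = 1"
  obtains r :: "nat \<Rightarrow> real" and s where "\<And>i. r i > 0" "s \<in> measurable \<mu> (count_space UNIV)"
    "\<And>u. u \<in> Omega (dual_cone C) \<Longrightarrow> s u < n"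
    "\<And>u i. u \<in> Omega (dual_cone C) \<Longrightarrow> i < n \<Longrightarrow> u \<bullet> (r i *\<^sub>R v i) \<le> u \<bullet> (r (s u) *\<^sub>R v (s u))"
    "\<And>i. i < n \<Longrightarrow> measure \<mu> {u \<in> space \<mu>. s u = i} = w i"
proof -
  interpret prob_space \<mu> by fact
  let ?W = "Omega (dual_cone C)"
  have space: "space \<mu> = ?W"
    using sets_eq_imp_space_eq[OF sets] by (simp add: space_restrict_space)
  have id [measurable]: "(\<lambda>u. u) \<in> borel_measurable \<mu>"
    using sets by (simp add: measurable_cong_sets[OF sets refl] measurable_restrict_space1)
  define c where "c i u = ln (- (u \<bullet> v i))" for i u
  have neg: "- (u \<bullet> v i) > 0" if "u \<in> ?W" "i < n" for u i
    using Omega_inner_neg[OF that(1), of "v i"] OmegaD[OF v(1)[OF that(2)]] by force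
  have "\<exists>b. \<forall>u\<in>?W. \<bar>c i u\<bar> \<le> b" if i: "i < n" for i
  proof -
    obtain k where k: "k > 0" "\<And>u. u \<in> dual_cone C \<Longrightarrow> k * norm u \<le> - (u \<bullet> v i)"
      using dual_cone_Omega_bound[OF v(1)[OF i]] by blast
    have "\<bar>c i u\<bar> \<le> - ln k" if u: "u \<in> ?W" for u
    proof -
      have 1: "k \<le> - (u \<bullet> v i)" using k(2)[of u] OmegaD[OF u] by simp
      have 2: "- (u \<bullet> v i) \<le> 1"
        using Cauchy_Schwarz_ineq2[of u "v i"] OmegaD(1)[OF u] OmegaD(1)[OF v(1)[OF i]] by simp
      have "ln k \<le> c i u" unfolding c_def using 1 k(1) by (simp add: ln_mono)
      moreover have "c i u \<le> 0" unfolding c_def using 2 neg[OF u i] by (simp add: ln_le_zero_iff)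
      ultimately show ?thesis by simp
    qed
    then show ?thesis by blast
  qed
  then obtain b where b: "\<And>i u. i < n \<Longrightarrow> u \<in> ?W \<Longrightarrow> \<bar>c i u\<bar> \<le> b i" by metis
  have B: "\<bar>c i u\<bar> \<le> (\<Sum>j<n. \<bar>b j\<bar>)" if "i < n" "u \<in> space \<mu>" for i u
  proof -
    have "\<bar>b i\<bar> \<le> (\<Sum>j<n. \<bar>b j\<bar>)" using that by (intro member_le_sum) auto
    then show ?thesis using b[of i u] that space by simp
  qed
  have ties: "AE u in \<mu>. a + c i u \<noteq> c j u" if ij: "i < n" "j < n" "i \<noteq> j" for i j a
  proof -
    \<comment> \<open>A tie says that u is a normal vector of this two-point set at both of its
      points; they differ because distinct unit vectors span distinct rays.\<close>
    let ?P = "{exp a *\<^sub>R v i, v j}"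
    let ?N = "{u \<in> ?W. \<exists>x y. x \<noteq> y \<and> normal_vector ?P x u \<and> normal_vector ?P y u}"
    have "?N \<in> null_sets \<mu>"
      by (rule null_sets_multiple_normals[OF sets null v(1)[OF n]]) auto
    moreover have "{u \<in> space \<mu>. \<not> (a + c i u \<noteq> c j u)} \<subseteq> ?N"
    proof
      fix u assume "u \<in> {u \<in> space \<mu>. \<not> (a + c i u \<noteq> c j u)}"
      then have u: "u \<in> ?W" "a + c i u = c j u" using space by auto
      have "exp (a + c i u) = exp (c j u)" using u by simp
      then have "exp a * (- (u \<bullet> v i)) = - (u \<bullet> v j)"
        unfolding c_def exp_add using neg[OF u(1) ij(1)] neg[OF u(1) ij(2)] by simp
      then have eq: "u \<bullet> (exp a *\<^sub>R v i) = u \<bullet> v j" by simp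
      have "exp a *\<^sub>R v i \<noteq> v j"
      proof
        assume e: "exp a *\<^sub>R v i = v j"
        then have "norm (exp a *\<^sub>R v i) = 1" using OmegaD(1)[OF v(1)[OF ij(2)]] by simp
        then have "exp a = 1" using OmegaD(1)[OF v(1)[OF ij(1)]] by simp
        then have "v i = v j" using e by simp
        then show False using v(2) ij by (auto dest: inj_onD)
      qed
      then show "u \<in> ?N"
        using u(1) eq OmegaD(1)[OF u(1)]
        unfolding normal_vector_def
        by (intro CollectI conjI exI[of _ "exp a *\<^sub>R v i"] exI[of _ "v j"]) auto
    qed
    ultimately show ?thesis by (rule AE_I')
  qed
  obtain t where t: "\<And>i. i < n \<Longrightarrow> measure \<mu> {u \<in> space \<mu>. \<forall>j<n. t i + c i u \<le> t j + c j u} = w i"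
  proof (rule semi_discrete_potentials[of \<mu> n c "\<Sum>j<n. \<bar>b j\<bar>" w])
    show "c i \<in> borel_measurable \<mu>" if "i < n" for i unfolding c_def by measurable
  qed (use assms(1) n B w ties in \<open>auto intro!: sum_nonneg\<close>)
  \<comment> \<open>The least optimal index gives a measurable selection defined everywhere; the
    choice matters only on ties, a null set.\<close>
  define s where "s u = (LEAST i. i < n \<and> (\<forall>j<n. t i + c i u \<le> t j + c j u))" for u
  have c_meas [measurable]: "c i \<in> borel_measurable \<mu>" for i unfolding c_def by measurable
  have ex: "\<exists>i. i < n \<and> (\<forall>j<n. t i + c i u \<le> t j + c j u)" for u
  proof -
    have "(\<lambda>i. t i + c i u) ` {..<n} \<noteq> {}" using n by auto
    then have "Min ((\<lambda>i. t i + c i u) ` {..<n}) \<in> (\<lambda>i. t i + c i u) ` {..<n}"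
      by (intro Min_in) auto
    then obtain i where i: "i < n" "Min ((\<lambda>i. t i + c i u) ` {..<n}) = t i + c i u" by auto
    have "t i + c i u \<le> t j + c j u" if "j < n" for j
      unfolding i(2)[symmetric] using that by (intro Min_le) auto
    then show ?thesis using i(1) by blast
  qed
  have s: "s u < n" "\<And>j. j < n \<Longrightarrow> t (s u) + c (s u) u \<le> t j + c j u" for u
    unfolding s_def using LeastI_ex[OF ex[of u]] by blast+
  show ?thesis
  proof (rule that[of "\<lambda>i. exp (t i)" s])
    show s_meas: "s \<in> measurable \<mu> (count_space UNIV)"
      unfolding s_def by measurable
    show "s u < n" for u by (rule s)
    fix u i assume u: "u \<in> ?W" "i < n"
    have "exp (t (s u) + c (s u) u) \<le> exp (t i + c i u)" using s(2)[OF u(2)] by simp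
    then have "exp (t (s u)) * (- (u \<bullet> v (s u))) \<le> exp (t i) * (- (u \<bullet> v i))"
      unfolding exp_add c_def using neg[OF u(1) u(2)] neg[OF u(1) s(1)[of u]] by simp
    then show "u \<bullet> (exp (t i) *\<^sub>R v i) \<le> u \<bullet> (exp (t (s u)) *\<^sub>R v (s u))" by simp
  next
    fix i assume i: "i < n"
    have "AE u in \<mu>. \<forall>j\<in>{..<n}. j \<noteq> i \<longrightarrow> t i - t j + c i u \<noteq> c j u"
    proof (intro AE_finite_allI finite_lessThan)
      fix j assume "j \<in> {..<n}"
      then show "AE u in \<mu>. j \<noteq> i \<longrightarrow> t i - t j + c i u \<noteq> c j u"
        using ties[OF i, of j "t i - t j"] by (cases "j = i") (auto elim: AE_mp)
    qed
    then have "measure \<mu> {u \<in> space \<mu>. s u = i} = measure \<mu> {u \<in> space \<mu>. \<forall>j<n. t i + c i u \<le> t j + c j u}"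
    proof (intro finite_measure_eq_AE)
      assume ae: "AE u in \<mu>. \<forall>j\<in>{..<n}. j \<noteq> i \<longrightarrow> t i - t j + c i u \<noteq> c j u"
      show "AE u in \<mu>. (u \<in> {u \<in> space \<mu>. s u = i}) = (u \<in> {u \<in> space \<mu>. \<forall>j<n. t i + c i u \<le> t j + c j u})"
        using ae
      proof eventually_elim
        case (elim u)
        have "s u = i" if "\<forall>j<n. t i + c i u \<le> t j + c j u"
          using that s(1)[of u] s(2)[OF i, of u] elim by (force simp: algebra_simps)
        then show ?case using s(2)[of _ u] by auto
      qed
      show "{u \<in> space \<mu>. s u = i} \<in> sets \<mu>" unfolding s_def by measurable
      show "{u \<in> space \<mu>. \<forall>j<n. t i + c i u \<le> t j + c j u} \<in> sets \<mu>" by measurable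
    qed
    then show "measure \<mu> {u \<in> space \<mu>. s u = i} = w i" using t[OF i] by simp
  qed simp
qed

section \<open>Limits of pseudo-cones\<close>

text \<open>An interior point of the dual cone stays in it after subtracting a small multiple of any
  u. This writes q as k u plus an element of the cone, the form in which values at q and u are
  compared.\<close>

lemma dual_cone_harnack:
  assumes q: "q \<in> interior (dual_cone C)"
  obtains k where "k > 0" "q - k *\<^sub>R u \<in> dual_cone C"
proof -
  obtain e where e: "e > 0" "cball q e \<subseteq> dual_cone C"
    using q unfolding mem_interior_cball by auto
  show ?thesis
  proof (rule that)
    \<comment> \<open>Adding 1 to the norm covers u = 0.\<close>
    show "e / (norm u + 1) > 0" using e by (simp add: add_nonneg_pos)
    have "e * norm u \<le> e * (norm u + 1)" using e by simp
    then have "dist q (q - (e / (norm u + 1)) *\<^sub>R u) \<le> e"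
      using e by (simp add: dist_norm divide_le_eq add_nonneg_pos)
    then show "q - (e / (norm u + 1)) *\<^sub>R u \<in> dual_cone C" using e(2) by auto
  qed
qed

lemma dual_cone_scaleR: "u \<in> dual_cone C \<Longrightarrow> a \<ge> 0 \<Longrightarrow> a *\<^sub>R u \<in> dual_cone C"
  by (auto simp: dual_cone_def mult_nonneg_nonpos)

text \<open>
  Write \<open>h N u = - (u \<bullet> X N u)\<close>. The \<open>h N\<close> are positive, superadditive and homogeneous, so the
  normalisation at \<open>u0\<close> bounds them from both sides on every direction (a Harnack inequality).
  Hence they converge along a subsequence on a countable dense set, and the limit is the
  (negated) support function of the pseudo-cone.
\<close>

lemma pseudo_cone_limit:
  fixes C :: "'a::euclidean_space set" and X :: "nat \<Rightarrow> 'a \<Rightarrow> 'a"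
  assumes C: "closed C" "convex C" "cone C" "C \<noteq> {}" and u0: "u0 \<in> Omega (dual_cone C)"
    and XC: "\<And>N u. u \<in> Omega (dual_cone C) \<Longrightarrow> X N u \<in> C"
    and opt: "\<And>N u u'. u \<in> Omega (dual_cone C) \<Longrightarrow> u' \<in> Omega (dual_cone C) \<Longrightarrow> u \<bullet> X N u' \<le> u \<bullet> X N u"
    and normalized: "\<And>N. u0 \<bullet> X N u0 = -1"
  obtains K r where "pseudo_cone C K" "strict_mono r"
    "\<And>u. u \<in> Omega (dual_cone C) - omega C K \<Longrightarrow> \<exists>x. normal_vector K x u \<and> (\<lambda>N. X (r N) u) \<longlonglongrightarrow> x"
proof -
  let ?W = "Omega (dual_cone C)"
  define h where "h N u = - (u \<bullet> X N u)" for N u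
  have C0: "0 \<in> C" using cone_contains_0[OF C(3)] C(4) by simp
  have Cadd: "x + y \<in> C" if "x \<in> C" "y \<in> C" for x y
  proof -
    have "(1/2) *\<^sub>R x + (1/2) *\<^sub>R y \<in> C" using C(2) that by (intro convexD) auto
    then have "2 *\<^sub>R ((1/2) *\<^sub>R x + (1/2) *\<^sub>R y) \<in> C" using C(3) unfolding cone_def by fastforce
    then show ?thesis by (simp add: scaleR_add_right)
  qed
  \<comment> \<open>The point \<open>X N q\<close> competes in the problem for u, and it lies in C,
    where q - k u is nonpositive.\<close>
  have harnack: "k * h N u \<le> h N q" if "q - k *\<^sub>R u \<in> dual_cone C" "k \<ge> 0" "u \<in> ?W" "q \<in> ?W" for k u q N
  proof -
    have "(q - k *\<^sub>R u) \<bullet> X N q \<le> 0" using that XC by (intro dual_cone_inner_le)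
    then have "q \<bullet> X N q \<le> k * (u \<bullet> X N q)" by (simp add: inner_diff_left)
    also have "\<dots> \<le> k * (u \<bullet> X N u)" using opt that by (intro mult_left_mono) auto
    finally show ?thesis by (simp add: h_def)
  qed
  have h0: "h N u0 = 1" for N by (simp add: h_def normalized)
  have lower: "\<exists>a>0. \<forall>N. a \<le> h N u" if u: "u \<in> ?W" for u
  proof -
    obtain k where "k > 0" "u - k *\<^sub>R u0 \<in> dual_cone C"
      using dual_cone_harnack[OF OmegaD(2)[OF u]] by blast
    then show ?thesis using harnack[of u k u0] u u0 h0 by (intro exI[of _ k]) auto
  qed
  have upper: "\<exists>b. \<forall>N. h N u \<le> b" if u: "u \<in> ?W" for u
  proof -
    obtain k where l: "k > 0" "u0 - k *\<^sub>R u \<in> dual_cone C"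
      using dual_cone_harnack[OF OmegaD(2)[OF u0]] by blast
    then have "k * h N u \<le> 1" for N using harnack[of u0 k u N] u u0 h0 by auto
    then have "h N u \<le> 1 / k" for N using l(1) by (simp add: field_simps)
    then show ?thesis by blast
  qed
  have bdd: "bounded (range (\<lambda>N. X (f N) u))" if u: "u \<in> ?W" for u f
  proof -
    obtain c where c: "c > 0" "\<And>x. x \<in> C \<Longrightarrow> c * norm x \<le> - (u \<bullet> x)"
      using Omega_dual_cone_bound[OF u] by blast
    obtain b where b: "\<And>N. h N u \<le> b" using upper[OF u] by blast
    have "norm (X N u) \<le> b / c" for N
    proof -
      have "c * norm (X N u) \<le> b" using c(2)[OF XC[OF u, of N]] b[of N] by (simp add: h_def)
      then show ?thesis using c(1) by (simp add: field_simps)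
    qed
    then show ?thesis by (auto simp: bounded_iff)
  qed
  obtain D where D: "countable D" "D \<subseteq> ?W" "?W \<subseteq> closure D" using separable by blast
  define q where "q = from_nat_into D"
  have "D \<noteq> {}" using D(3) u0 by auto
  then have qD: "range q = D" unfolding q_def using D(1) by (rule range_from_nat_into)
  then have qW: "q i \<in> ?W" for i using D(2) by blast
  obtain a where a: "\<And>i. a i > 0" "\<And>i N. a i \<le> h N (q i)" using lower[OF qW] by metis
  obtain b where b: "\<And>i N. h N (q i) \<le> b i" using upper[OF qW] by metis
  obtain r l where r: "strict_mono r" and l: "\<And>i. (\<lambda>N. h (r N) (q i)) \<longlonglongrightarrow> l i" "\<And>i. a i \<le> l i"
    using bounded_nat_sequences_converge_simultaneously[of a "\<lambda>N i. h N (q i)" b] a(2) b by blast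
  define K where "K = C \<inter> (\<Inter>i. {x. q i \<bullet> x \<le> - l i})"
  have limit: "x \<in> K" "\<And>y. y \<in> K \<Longrightarrow> u \<bullet> y \<le> u \<bullet> x"
    if u: "u \<in> ?W" and s: "strict_mono s" and x: "(\<lambda>N. X (r (s N)) u) \<longlonglongrightarrow> x" for u s x
  proof -
    have ls: "(\<lambda>N. h (r (s N)) (q i)) \<longlonglongrightarrow> l i" for i
      using LIMSEQ_subseq_LIMSEQ[OF l(1) s] by (simp add: o_def)
    have xC: "x \<in> C" using closed_sequentially[OF C(1) _ x] XC[OF u] by blast
    moreover have "q i \<bullet> x \<le> - l i" for i
    proof (rule LIMSEQ_le)
      show "(\<lambda>N. q i \<bullet> X (r (s N)) u) \<longlonglongrightarrow> q i \<bullet> x" using x by (intro tendsto_intros)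
      show "(\<lambda>N. - h (r (s N)) (q i)) \<longlonglongrightarrow> - l i" using ls by (intro tendsto_intros)
      show "\<exists>N. \<forall>n\<ge>N. q i \<bullet> X (r (s n)) u \<le> - h (r (s n)) (q i)"
        using opt[OF qW u] by (auto simp: h_def)
    qed
    ultimately show "x \<in> K" by (auto simp: K_def)
    fix y assume y: "y \<in> K"
    obtain e where e: "e > 0" "ball u e \<subseteq> dual_cone C"
      using OmegaD(2)[OF u] unfolding mem_interior by auto
    \<comment> \<open>A Harnack inequality with constant near 1 replaces continuity of the limit
      function: if q i is within d e of u, then q i - (1 - d) u is d times a point of the ball
      around u, hence in the dual cone. So (1 - d) (-(u . x)) is at most l i, and y in K satisfies
      the constraint for q i.\<close>
    have approx: "u \<bullet> y \<le> u \<bullet> x + d * (e * norm y - u \<bullet> x)" if d: "0 < d" "d < 1" for d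
    proof -
      have "u \<in> closure (range q)" using u D(3) qD by auto
      then obtain i where i: "dist (q i) u < d * e"
        using d e unfolding closure_approachable by (metis imageE mult_pos_pos)
      have "dist u (u + (1 / d) *\<^sub>R (q i - u)) < e"
      proof -
        have "dist u (u + z) = norm z" for z :: 'a by (simp add: dist_norm)
        then have "dist u (u + (1 / d) *\<^sub>R (q i - u)) = dist (q i) u / d"
          using d by (simp only: norm_scaleR dist_norm) simp
        then show ?thesis using i d by (simp add: pos_divide_less_eq mult.commute)
      qed
      then have "d *\<^sub>R (u + (1 / d) *\<^sub>R (q i - u)) \<in> dual_cone C"
        using e(2) d by (intro dual_cone_scaleR) auto
      also have "d *\<^sub>R (u + (1 / d) *\<^sub>R (q i - u)) = q i - (1 - d) *\<^sub>R u"
        using d by (simp add: algebra_simps)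
      finally have hq: "(1 - d) * h N u \<le> h N (q i)" for N
        using harnack[of "q i" "1 - d" u N] d u qW by auto
      have "(1 - d) * - (u \<bullet> x) \<le> l i"
      proof (rule LIMSEQ_le)
        show "(\<lambda>N. (1 - d) * h (r (s N)) u) \<longlonglongrightarrow> (1 - d) * - (u \<bullet> x)"
          unfolding h_def using x by (intro tendsto_intros)
        show "(\<lambda>N. h (r (s N)) (q i)) \<longlonglongrightarrow> l i" by (rule ls)
      qed (use hq in blast)
      moreover have "q i \<bullet> y \<le> - l i" using y by (auto simp: K_def)
      moreover have "u \<bullet> y - q i \<bullet> y \<le> d * e * norm y"
      proof -
        have "u \<bullet> y - q i \<bullet> y \<le> norm (u - q i) * norm y"
          using norm_cauchy_schwarz[of "u - q i" y] by (simp add: inner_diff_left)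
        also have "\<dots> \<le> d * e * norm y"
          using i by (intro mult_right_mono) (auto simp: dist_norm norm_minus_commute)
        finally show ?thesis .
      qed
      ultimately show ?thesis by (simp add: algebra_simps)
    qed
    have "(\<lambda>n. inverse (real (Suc n))) \<longlonglongrightarrow> 0" by (rule LIMSEQ_inverse_real_of_nat)
    then have "(\<lambda>n. u \<bullet> x + inverse (real (Suc n)) * (e * norm y - u \<bullet> x)) \<longlonglongrightarrow> u \<bullet> x + 0 * (e * norm y - u \<bullet> x)"
      by (intro tendsto_intros)
    \<comment> \<open>The bound starts at n = 1, because n = 0 would give d = 1.\<close>
    moreover have "\<exists>N. \<forall>n\<ge>N. u \<bullet> y \<le> u \<bullet> x + inverse (real (Suc n)) * (e * norm y - u \<bullet> x)"
      by (intro exI[of _ 1] allI impI approx) (auto simp: field_simps)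
    ultimately show "u \<bullet> y \<le> u \<bullet> x" using LIMSEQ_le_const[of _ "u \<bullet> x" "u \<bullet> y"] by simp
  qed
  have sub: "\<exists>x s. strict_mono s \<and> (\<lambda>N. X (r (s N)) u) \<longlonglongrightarrow> x" if "u \<in> ?W" for u
    using bounded_imp_convergent_subsequence[OF bdd[OF that, of r]] by (auto simp: o_def)
  show ?thesis
  proof (rule that[of K r])
    show "strict_mono r" by fact
    show "pseudo_cone C K"
      unfolding pseudo_cone_def
    proof (intro conjI)
      show "K \<noteq> {}" using sub[OF u0] limit(1)[OF u0] by blast
      show "closed K" unfolding K_def using C(1) by (intro closed_Int closed_INT ballI closed_halfspace_le)
      show "convex K" unfolding K_def using C(2) by (intro convex_Int convex_INT convex_halfspace_le)
      show "K \<subseteq> C" by (auto simp: K_def)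
      \<comment> \<open>The uniform lower bound on h passes to the limit, so l 0 is positive and the
        half-space for q 0 excludes the origin.\<close>
      show "0 \<notin> K"
      proof
        assume "0 \<in> K"
        then have "q 0 \<bullet> 0 \<le> - l 0" by (auto simp: K_def)
        then show False using a(1)[of 0] l(2)[of 0] by simp
      qed
      show "K + C = K"
      proof
        show "K + C \<subseteq> K"
        proof
          fix z assume "z \<in> K + C"
          then obtain x y where z: "z = x + y" "x \<in> K" "y \<in> C" by (auto elim: set_plus_elim)
          have "q i \<bullet> (x + y) \<le> - l i" for i
          proof -
            have "q i \<bullet> y \<le> 0" using OmegaD(3)[OF qW] z(3) by (intro dual_cone_inner_le)
            moreover have "q i \<bullet> x \<le> - l i" using z(2) by (auto simp: K_def)
            ultimately show ?thesis by (simp add: inner_add_right)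
          qed
          then show "z \<in> K" using z Cadd by (auto simp: K_def)
        qed
        show "K \<subseteq> K + C" using set_plus_intro[OF _ C0, of _ K] by auto
      qed
    qed
    fix u assume u: "u \<in> ?W - omega C K"
    have nv: "normal_vector K x u" if "strict_mono s" "(\<lambda>N. X (r (s N)) u) \<longlonglongrightarrow> x" for s x
      using limit[of u s x] that u OmegaD(1)[of u] by (auto simp: normal_vector_def)
    obtain x s where x: "strict_mono s" "(\<lambda>N. X (r (s N)) u) \<longlonglongrightarrow> x" using sub u by blast
    \<comment> \<open>Every subsequential limit is a point of K with normal vector u; outside
      \<open>omega C K\<close> there is only one, so the chosen subsequence r works for all such u
      at once.\<close>
    have "(\<lambda>N. X (r N) u) \<longlonglongrightarrow> x"
    proof (rule tendsto_of_unique_subsequential_limit)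
      show "bounded (range (\<lambda>N. X (r N) u))" using bdd u by blast
      fix s' y assume s': "strict_mono s'" "((\<lambda>N. X (r N) u) \<circ> s') \<longlonglongrightarrow> y"
      then have "normal_vector K y u" using nv by (simp add: o_def)
      moreover have "u \<in> closure ?W" using u closure_subset by blast
      ultimately show "y = x" using u nv[OF x] unfolding omega_def by blast
    qed
    then show "\<exists>x. normal_vector K x u \<and> (\<lambda>N. X (r N) u) \<longlonglongrightarrow> x" using nv[OF x] by blast
  qed
qed

section \<open>Discrete approximation and image measures\<close>

text \<open>Closed sets form an intersection-stable generator, and the indicator of a nonempty
  closed set is the pointwise limit of the continuous functions max 0 (1 - k dist(x, F)).\<close>

lemma finite_borel_measure_eqI_continuous:
  fixes M N :: "'a::metric_space measure"
  assumes "finite_measure M" "finite_measure N" and sets: "sets M = sets borel" "sets N = sets borel"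
    and eq: "\<And>g :: 'a \<Rightarrow> real. continuous_on UNIV g \<Longrightarrow> (\<And>x. 0 \<le> g x \<and> g x \<le> 1) \<Longrightarrow>
      (\<integral>x. g x \<partial>M) = (\<integral>x. g x \<partial>N)"
  shows "M = N"
proof (rule measure_eqI_generator_eq)
  interpret M: finite_measure M by fact
  interpret N: finite_measure N by fact
  show "Int_stable (Collect closed :: 'a set set)" by (auto simp: Int_stable_def)
  show "sets M = sigma_sets UNIV (Collect closed)" "sets N = sigma_sets UNIV (Collect closed)"
    unfolding sets by (simp_all add: borel_eq_closed)
  show "range (\<lambda>_::nat. UNIV) \<subseteq> Collect (closed :: 'a set \<Rightarrow> bool)" by auto
  show "emeasure M UNIV \<noteq> \<infinity>" by simp
  fix F :: "'a set" assume "F \<in> Collect closed"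
  then have F: "closed F" by simp
  show "emeasure M F = emeasure N F"
  \<comment> \<open>\<open>infdist\<close> to the empty set is 0 by convention, which would make the
    approximating functions constantly 1.\<close>
  proof (cases "F = {}")
    case False
    define g where "g k x = max 0 (1 - real k * infdist x F)" for k x
    have cont: "continuous_on UNIV (g k)" for k
      unfolding g_def by (intro continuous_intros)
    have g01: "0 \<le> g k x \<and> g k x \<le> 1" for k x
      unfolding g_def using infdist_nonneg[of x F] by auto
    have lim: "(\<lambda>k. g k x) \<longlonglongrightarrow> indicator F x" for x
    proof (cases "x \<in> F")
      case True
      then show ?thesis by (simp add: g_def)
    next
      case False
      have "infdist x F \<noteq> 0" using in_closed_iff_infdist_zero[OF F \<open>F \<noteq> {}\<close>, of x] False by simp
      then have pos: "infdist x F > 0" using infdist_nonneg[of x F] by linarith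
      obtain K :: nat where K: "1 < real K * infdist x F"
        using reals_Archimedean3[OF pos] by blast
      have "g k x = 0" if "k \<ge> K" for k
      proof -
        have "real K * infdist x F \<le> real k * infdist x F" using that pos by (intro mult_right_mono) auto
        then show ?thesis using K by (simp add: g_def)
      qed
      then have "\<forall>\<^sub>F k in sequentially. g k x = 0" by (auto simp: eventually_sequentially)
      then show ?thesis using False by (simp add: tendsto_eventually)
    qed
    have int: "(\<lambda>k. \<integral>x. g k x \<partial>L) \<longlonglongrightarrow> measure L F" if "finite_measure L" "sets L = sets borel" for L
    proof -
      interpret L: finite_measure L by fact
      have "(\<lambda>k. \<integral>x. g k x \<partial>L) \<longlonglongrightarrow> (\<integral>x. indicator F x \<partial>L)"
      proof (rule integral_dominated_convergence[where w = "\<lambda>_. 1"])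
        show "indicator F \<in> borel_measurable L" using F that(2) by (intro borel_measurable_indicator) auto
        show "g k \<in> borel_measurable L" for k
          using borel_measurable_continuous_onI[OF cont[of k]] measurable_cong_sets[OF that(2) refl] by blast
      qed (use lim g01 in auto)
      moreover have "F \<inter> space L = F" using sets_eq_imp_space_eq[OF that(2)] by simp
      ultimately show ?thesis by simp
    qed
    have "measure M F = measure N F"
      using int[OF assms(1,3)] int[OF assms(2,4)] eq[OF cont g01] by (simp add: LIMSEQ_unique)
    then show ?thesis by (simp add: M.emeasure_eq_measure N.emeasure_eq_measure)
  qed simp
qed auto

text \<open>Applied to the selected index under mu and to the simple function itself under
  nu.\<close>

lemma (in finite_measure) integral_finite_range:
  fixes g :: "'b \<Rightarrow> real"
  assumes I: "finite I" "\<And>x. x \<in> space M \<Longrightarrow> k x \<in> I"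
    and k: "\<And>i. i \<in> I \<Longrightarrow> {x \<in> space M. k x = i} \<in> sets M"
  shows "(\<integral>x. g (k x) \<partial>M) = (\<Sum>i\<in>I. g i * measure M {x \<in> space M. k x = i})"
proof -
  have "(\<integral>x. g (k x) \<partial>M) = (\<integral>x. (\<Sum>i\<in>I. g i * indicator {x \<in> space M. k x = i} x) \<partial>M)"
  proof (rule Bochner_Integration.integral_cong)
    fix x assume x: "x \<in> space M"
    have "(\<Sum>i\<in>I. g i * indicator {x \<in> space M. k x = i} x) = (\<Sum>i\<in>I. if i = k x then g i else 0)"
      using x by (intro sum.cong) (auto simp: indicator_def)
    then show "g (k x) = (\<Sum>i\<in>I. g i * indicator {x \<in> space M. k x = i} x)"
      using I x by simp
  qed simp
  also have "\<dots> = (\<Sum>i\<in>I. \<integral>x. g i * indicator {x \<in> space M. k x = i} x \<partial>M)"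
    using k by (intro Bochner_Integration.integral_sum integrable_mult_right integrable_real_indicator)
      (auto simp: emeasure_eq_measure)
  also have "\<dots> = (\<Sum>i\<in>I. g i * measure M {x \<in> space M. k x = i})"
    by (intro sum.cong) (auto intro!: arg_cong[where f = "measure M"])
  finally show ?thesis .
qed

text \<open>Simple approximations of the identity may leave \<open>Omega C\<close>. They are
  projected radially to the sphere, with \<open>v0\<close> as fallback; since \<open>Omega C\<close>
  is open in the sphere, the fallback is used only finitely often at each x.\<close>

lemma simple_functions_tendsto_identity:
  fixes C :: "'a::euclidean_space set"
  assumes v0: "v0 \<in> Omega C" and sets: "sets \<nu> = sets (restrict_space borel (Omega C))"
  obtains f where "\<And>k. simple_function \<nu> (f k)" "\<And>k x. f k x \<in> Omega C"
    "\<And>x. x \<in> Omega C \<Longrightarrow> (\<lambda>k. f k x) \<longlonglongrightarrow> x"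
proof -
  have space: "space \<nu> = Omega C"
    using sets_eq_imp_space_eq[OF sets] by (simp add: space_restrict_space)
  have "(\<lambda>x. x) \<in> borel_measurable \<nu>"
    using sets by (simp add: measurable_cong_sets[OF sets refl] measurable_restrict_space1)
  then obtain F where F: "\<And>i. simple_function \<nu> (F i)" "\<And>x. x \<in> Omega C \<Longrightarrow> (\<lambda>i. F i x) \<longlonglongrightarrow> x"
    using borel_measurable_implies_sequence_metric[of "\<lambda>x. x" \<nu>] unfolding space by blast
  define p where "p y = (if y /\<^sub>R norm y \<in> Omega C then y /\<^sub>R norm y else v0)" for y
  show ?thesis
  proof (rule that[of "\<lambda>k x. p (F k x)"])
    show "simple_function \<nu> (\<lambda>x. p (F k x))" for k using F(1) by (rule simple_function_compose1)
    show "p (F k x) \<in> Omega C" for k x using v0 by (simp add: p_def)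
    fix x assume x: "x \<in> Omega C"
    have nx: "norm x = 1" using OmegaD(1)[OF x] .
    have "(\<lambda>k. F k x /\<^sub>R norm (F k x)) \<longlonglongrightarrow> x /\<^sub>R norm x"
      using F(2)[OF x] nx by (intro tendsto_intros) auto
    then have lim: "(\<lambda>k. F k x /\<^sub>R norm (F k x)) \<longlonglongrightarrow> x" using nx by simp
    then have "\<forall>\<^sub>F k in sequentially. F k x /\<^sub>R norm (F k x) \<in> interior C"
      using OmegaD(2)[OF x] by (intro topological_tendstoD) auto
    moreover have "\<forall>\<^sub>F k in sequentially. F k x \<noteq> 0"
      using F(2)[OF x] nx by (intro tendsto_imp_eventually_ne) auto
    ultimately have "\<forall>\<^sub>F k in sequentially. F k x /\<^sub>R norm (F k x) = p (F k x)"
      by eventually_elim (simp add: p_def Omega_def)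
    then show "(\<lambda>k. p (F k x)) \<longlonglongrightarrow> x" by (rule Lim_transform_eventually[OF lim])
  qed
qed

text \<open>The atoms of the law of f are the directions of the semi-discrete problem. The
  directions S are returned beside the points X because the integrals involve only directions; g may
  be any real function since S and f have finite range and measurable fibres.\<close>

lemma discrete_reverse_gauss:
  fixes C :: "'a::euclidean_space set" and f :: "'a \<Rightarrow> 'a"
  assumes "prob_space \<mu>" and sets: "sets \<mu> = sets (restrict_space borel (Omega (dual_cone C)))"
    and null: "\<And>A. A \<in> sets \<mu> \<Longrightarrow> hausdorff_dim A \<le> ereal (real DIM('a) - 2) \<Longrightarrow> emeasure \<mu> A = 0"
    and cone: "cone C" and u0: "u0 \<in> Omega (dual_cone C)"
    and "prob_space \<nu>" and f: "simple_function \<nu> f" "\<And>x. f x \<in> Omega C"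
  obtains X S where "S \<in> borel_measurable \<mu>" "\<And>u. u \<in> Omega (dual_cone C) \<Longrightarrow> X u \<in> C"
    "\<And>u. u \<in> Omega (dual_cone C) \<Longrightarrow> S u = X u /\<^sub>R norm (X u)"
    "\<And>u u'. u \<in> Omega (dual_cone C) \<Longrightarrow> u' \<in> Omega (dual_cone C) \<Longrightarrow> u \<bullet> X u' \<le> u \<bullet> X u"
    "u0 \<bullet> X u0 = -1"
    "\<And>g :: 'a \<Rightarrow> real. (\<integral>u. g (S u) \<partial>\<mu>) = (\<integral>x. g (f x) \<partial>\<nu>)"
proof -
  interpret M: prob_space \<mu> by fact
  interpret N: prob_space \<nu> by fact
  let ?W = "Omega (dual_cone C)"
  have space: "space \<mu> = ?W"
    using sets_eq_imp_space_eq[OF sets] by (simp add: space_restrict_space)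
  define p where "p y = measure \<nu> {x \<in> space \<nu>. f x = y}" for y
  \<comment> \<open>Values of mass 0 are dropped, because the semi-discrete problem requires
    positive weights.\<close>
  define V where "V = {y \<in> f ` space \<nu>. p y > 0}"
  have fin: "finite (f ` space \<nu>)" using f(1) by (rule simple_functionD)
  have f_sets: "{x \<in> space \<nu>. f x = y} \<in> sets \<nu>" for y
    using simple_functionD(2)[OF f(1), of "{y}"] by (simp add: vimage_def Int_def conj_commute)
  have int_f: "(\<integral>x. g (f x) \<partial>\<nu>) = (\<Sum>y\<in>V. g y * p y)" for g :: "'a \<Rightarrow> real"
  proof -
    have "(\<integral>x. g (f x) \<partial>\<nu>) = (\<Sum>y\<in>f ` space \<nu>. g y * p y)"
      unfolding p_def using fin f_sets by (intro N.integral_finite_range) auto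
    also have "\<dots> = (\<Sum>y\<in>V. g y * p y)"
      using fin by (intro sum.mono_neutral_right) (auto simp: V_def p_def zero_less_measure_iff)
    finally show ?thesis .
  qed
  have finV: "finite V" using fin by (simp add: V_def)
  obtain v where v: "bij_betw v {0..<card V} V" using ex_bij_betw_nat_finite[OF finV] by blast
  define n where "n = card V"
  have v': "bij_betw v {..<n} V" using v by (simp add: n_def lessThan_atLeast0)
  have vV: "v i \<in> V" if "i < n" for i using bij_betwE[OF v'] that by auto
  have vO: "v i \<in> Omega C" if "i < n" for i using vV[OF that] f(2) by (auto simp: V_def)
  have sum_V: "(\<Sum>y\<in>V. g y) = (\<Sum>i<n. g (v i))" for g :: "'a \<Rightarrow> real"
    using sum.reindex_bij_betw[OF v', of g] by simp
  have sum1: "(\<Sum>i<n. p (v i)) = 1"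
    using int_f[of "\<lambda>_. 1"] sum_V[of p] by (simp add: N.prob_space)
  then have n: "n > 0" by (cases n) auto
  obtain r :: "nat \<Rightarrow> real" and s where r: "\<And>i. r i > 0" and s_meas: "s \<in> measurable \<mu> (count_space UNIV)"
    and s: "\<And>u. u \<in> ?W \<Longrightarrow> s u < n"
    and opt: "\<And>u i. u \<in> ?W \<Longrightarrow> i < n \<Longrightarrow> u \<bullet> (r i *\<^sub>R v i) \<le> u \<bullet> (r (s u) *\<^sub>R v (s u))"
    and meas: "\<And>i. i < n \<Longrightarrow> measure \<mu> {u \<in> space \<mu>. s u = i} = p (v i)"
  proof (rule semi_discrete_reverse_gauss[OF assms(1) sets null n, of v "\<lambda>i. p (v i)"])
    show "inj_on v {..<n}" using v' by (rule bij_betw_imp_inj_on)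
  qed (use vO vV sum1 in \<open>auto simp: V_def\<close>)
  \<comment> \<open>Dividing all points by z gives the normalisation at u0 and preserves both
    directions and optimality.\<close>
  define z where "z = - (u0 \<bullet> (r (s u0) *\<^sub>R v (s u0)))"
  have "u0 \<bullet> v (s u0) < 0"
    using Omega_inner_neg[OF u0, of "v (s u0)"] OmegaD[OF vO[OF s[OF u0]]] by force
  then have z: "z > 0" using r[of "s u0"] by (simp add: z_def mult_pos_neg)
  define X where "X u = (r (s u) / z) *\<^sub>R v (s u)" for u
  show ?thesis
  proof (rule that[of "\<lambda>u. v (s u)" X])
    show "(\<lambda>u. v (s u)) \<in> borel_measurable \<mu>"
      using measurable_compose[OF s_meas, of v borel] by simp
    fix u assume u: "u \<in> ?W"
    have pos: "r (s u) / z > 0" using r z by simp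
    show "X u \<in> C"
      unfolding X_def using cone OmegaD(3)[OF vO[OF s[OF u]]] pos by (simp add: cone_def)
    show "v (s u) = X u /\<^sub>R norm (X u)"
      unfolding X_def using OmegaD(1)[OF vO[OF s[OF u]]] r[of "s u"] z by simp
    fix u' assume u': "u' \<in> ?W"
    have "(u \<bullet> (r (s u') *\<^sub>R v (s u'))) / z \<le> (u \<bullet> (r (s u) *\<^sub>R v (s u))) / z"
      using opt[OF u s[OF u']] z by (intro divide_right_mono) auto
    then show "u \<bullet> X u' \<le> u \<bullet> X u" by (simp add: X_def)
  next
    have "u0 \<bullet> X u0 = (u0 \<bullet> (r (s u0) *\<^sub>R v (s u0))) / z" by (simp add: X_def)
    also have "\<dots> = - z / z" by (simp add: z_def)
    also have "\<dots> = -1" using z by simp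
    finally show "u0 \<bullet> X u0 = -1" .
  next
    fix g :: "'a \<Rightarrow> real"
    have "{u \<in> space \<mu>. s u = i} \<in> sets \<mu>" for i
      using measurable_sets[OF s_meas, of "{i}"] by (simp add: vimage_def Int_def conj_commute)
    then have "(\<integral>u. g (v (s u)) \<partial>\<mu>) = (\<Sum>i<n. g (v i) * measure \<mu> {u \<in> space \<mu>. s u = i})"
      using s space by (intro M.integral_finite_range[of "{..<n}" s "\<lambda>i. g (v i)"]) auto
    also have "\<dots> = (\<integral>x. g (f x) \<partial>\<nu>)"
      unfolding int_f sum_V using meas by (intro sum.cong) auto
    finally show "(\<integral>u. g (v (s u)) \<partial>\<mu>) = (\<integral>x. g (f x) \<partial>\<nu>)" .
  qed
qed

section \<open>The limit map and its image measure\<close>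

lemma reverse_radial_gauss_eq:
  assumes x: "normal_vector K x u" "x \<noteq> 0" and uniq: "\<And>y. normal_vector K y u \<Longrightarrow> y = x"
  shows "reverse_radial_gauss K u = x /\<^sub>R norm x"
  unfolding reverse_radial_gauss_def
proof (rule the_equality)
  show "x /\<^sub>R norm x \<in> sphere 0 1 \<and> (\<exists>r>0. normal_vector K (r *\<^sub>R (x /\<^sub>R norm x)) u)"
    using x by (auto intro!: exI[of _ "norm x"])
  fix v assume "v \<in> sphere 0 1 \<and> (\<exists>r>0. normal_vector K (r *\<^sub>R v) u)"
  then obtain r where r: "norm v = 1" "r > 0" "normal_vector K (r *\<^sub>R v) u" by auto
  then have "x = r *\<^sub>R v" using uniq by metis
  then show "v = x /\<^sub>R norm x" using r by simp
qed

theorem theorem1: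
  fixes C :: "(real ^ 'n) set"
    and \<mu> \<nu> :: "(real ^ 'n) measure"
  assumes "closed C" and "convex C" and "cone C"
    and "\<not> contains_line C"
    and "interior C \<noteq> {}"
    and "prob_space \<mu>" and "sets \<mu> = sets (restrict_space borel (Omega (dual_cone C)))"
    and "prob_space \<nu>" and "sets \<nu> = sets (restrict_space borel (Omega C))"
    and "\<And>A. A \<in> sets \<mu> \<Longrightarrow> hausdorff_dim A \<le> ereal (real CARD('n) - 2) \<Longrightarrow> emeasure \<mu> A = 0"
  shows "\<exists>K. pseudo_cone C K \<and>
           (\<forall>\<eta>. \<eta> \<in> sets borel \<and> \<eta> \<subseteq> Omega C \<longrightarrow>
              reverse_radial_gauss_preimage C K \<eta> \<in> sets \<mu> \<and>
              emeasure \<mu> (reverse_radial_gauss_preimage C K \<eta>) = emeasure \<nu> \<eta>)"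
proof -
  interpret M: prob_space \<mu> by fact
  interpret N: prob_space \<nu> by fact
  let ?W = "Omega (dual_cone C)"
  note setsM = assms(7) and setsN = assms(9)
  have null: "\<And>A. A \<in> sets \<mu> \<Longrightarrow> hausdorff_dim A \<le> ereal (real DIM(real ^ 'n) - 2) \<Longrightarrow> emeasure \<mu> A = 0"
    using assms(10) by simp
  have spaceM: "space \<mu> = ?W"
    using sets_eq_imp_space_eq[OF setsM] by (simp add: space_restrict_space)
  have spaceN: "space \<nu> = Omega C"
    using sets_eq_imp_space_eq[OF setsN] by (simp add: space_restrict_space)
  obtain u0 where u0: "u0 \<in> ?W" using M.not_empty spaceM by blast
  obtain v0 where v0: "v0 \<in> Omega C" using N.not_empty spaceN by blast
  obtain f where f: "\<And>k. simple_function \<nu> (f k)" "\<And>k x. f k x \<in> Omega C"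
    "\<And>x. x \<in> Omega C \<Longrightarrow> (\<lambda>k. f k x) \<longlonglongrightarrow> x"
    using simple_functions_tendsto_identity[OF v0 setsN] by blast
  have "\<forall>k. \<exists>X S. S \<in> borel_measurable \<mu> \<and> (\<forall>u\<in>?W. X u \<in> C) \<and> (\<forall>u\<in>?W. S u = X u /\<^sub>R norm (X u)) \<and>
    (\<forall>u\<in>?W. \<forall>u'\<in>?W. u \<bullet> X u' \<le> u \<bullet> X u) \<and> u0 \<bullet> X u0 = -1 \<and>
    (\<forall>g :: real ^ 'n \<Rightarrow> real. (\<integral>u. g (S u) \<partial>\<mu>) = (\<integral>x. g (f k x) \<partial>\<nu>))"
  proof
    fix k
    show "\<exists>X S. S \<in> borel_measurable \<mu> \<and> (\<forall>u\<in>?W. X u \<in> C) \<and> (\<forall>u\<in>?W. S u = X u /\<^sub>R norm (X u)) \<and>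
      (\<forall>u\<in>?W. \<forall>u'\<in>?W. u \<bullet> X u' \<le> u \<bullet> X u) \<and> u0 \<bullet> X u0 = -1 \<and>
      (\<forall>g :: real ^ 'n \<Rightarrow> real. (\<integral>u. g (S u) \<partial>\<mu>) = (\<integral>x. g (f k x) \<partial>\<nu>))"
      by (rule discrete_reverse_gauss[OF assms(6) setsM null assms(3) u0 assms(8) f(1,2), of k]) blast+
  qed
  then obtain X S where S_meas: "\<And>k. S k \<in> borel_measurable \<mu>" and XC: "\<And>k u. u \<in> ?W \<Longrightarrow> X k u \<in> C"
    and SX: "\<And>k u. u \<in> ?W \<Longrightarrow> S k u = X k u /\<^sub>R norm (X k u)"
    and opt: "\<And>k u u'. u \<in> ?W \<Longrightarrow> u' \<in> ?W \<Longrightarrow> u \<bullet> X k u' \<le> u \<bullet> X k u"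
    and normalized: "\<And>k. u0 \<bullet> X k u0 = -1"
    and int: "\<And>k (g :: real ^ 'n \<Rightarrow> real). (\<integral>u. g (S k u) \<partial>\<mu>) = (\<integral>x. g (f k x) \<partial>\<nu>)"
    by metis
  have "C \<noteq> {}" using assms(5) by auto
  then obtain K r where K: "pseudo_cone C K" and r: "strict_mono r"
    and conv: "\<And>u. u \<in> ?W - omega C K \<Longrightarrow> \<exists>x. normal_vector K x u \<and> (\<lambda>k. X (r k) u) \<longlonglongrightarrow> x"
    using pseudo_cone_limit[OF assms(1,2,3) _ u0, of X] XC opt normalized by metis
  define D where "D = ?W - omega C K"
  have W_cl: "u \<in> closure ?W" if "u \<in> ?W" for u using that closure_subset by blast
  have omega_null: "?W \<inter> omega C K \<in> null_sets \<mu>"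
  proof -
    have "closed K" using K by (simp add: pseudo_cone_def)
    have "{u \<in> ?W. \<exists>x y. x \<noteq> y \<and> normal_vector K x u \<and> normal_vector K y u} \<in> null_sets \<mu>"
      by (rule null_sets_multiple_normals[OF setsM null v0 \<open>closed K\<close>])
    also have "{u \<in> ?W. \<exists>x y. x \<noteq> y \<and> normal_vector K x u \<and> normal_vector K y u} = ?W \<inter> omega C K"
      using W_cl by (auto simp: omega_def)
    finally show ?thesis .
  qed
  have D_eq: "D = space \<mu> - ?W \<inter> omega C K" using spaceM by (auto simp: D_def)
  have D_sets [measurable]: "D \<in> sets \<mu>" unfolding D_eq using omega_null by (intro sets.Diff) auto
  have AE_D: "AE u in \<mu>. u \<in> D"
    using AE_not_in[OF omega_null] AE_space by eventually_elim (simp add: D_eq)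
  have lim: "(\<lambda>k. S (r k) u) \<longlonglongrightarrow> reverse_radial_gauss K u" if u: "u \<in> D" for u
  proof -
    obtain x where x: "normal_vector K x u" "(\<lambda>k. X (r k) u) \<longlonglongrightarrow> x" using conv u by (auto simp: D_def)
    have "x \<in> K" using x by (simp add: normal_vector_def)
    then have x0: "x \<noteq> 0" using K by (auto simp: pseudo_cone_def)
    have "y = x" if "normal_vector K y u" for y
      using u x(1) that W_cl[of u] by (auto simp: D_def omega_def)
    then have "reverse_radial_gauss K u = x /\<^sub>R norm x" using x(1) x0 by (intro reverse_radial_gauss_eq)
    moreover have "(\<lambda>k. X (r k) u /\<^sub>R norm (X (r k) u)) \<longlonglongrightarrow> x /\<^sub>R norm x"
      using x(2) x0 by (intro tendsto_intros) auto
    ultimately show ?thesis using SX u by (simp add: D_def)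
  qed
  \<comment> \<open>The value \<open>v0\<close> outside D makes T an everywhere pointwise limit of
    measurable maps; it does not affect the image measure, since D has full measure.\<close>
  define T where "T u = (if u \<in> D then reverse_radial_gauss K u else v0)" for u
  have T_meas [measurable]: "T \<in> borel_measurable \<mu>"
  proof (rule borel_measurable_LIMSEQ_metric[of "\<lambda>k u. if u \<in> D then S (r k) u else v0"])
    show "(\<lambda>u. if u \<in> D then S (r k) u else v0) \<in> borel_measurable \<mu>" for k
      using S_meas by measurable
    show "(\<lambda>k. if u \<in> D then S (r k) u else v0) \<longlonglongrightarrow> T u" for u
      using lim by (auto simp: T_def)
  qed
  have id_meas [measurable]: "(\<lambda>x. x) \<in> borel_measurable \<nu>"
    using setsN by (simp add: measurable_cong_sets[OF setsN refl] measurable_restrict_space1)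
  \<comment> \<open>The comparison takes place on the whole space because T u may lie on the
    boundary of C. Equality shows that this happens only on a null set, as nu lives on
    \<open>Omega C\<close>.\<close>
  have "distr \<mu> borel T = distr \<nu> borel (\<lambda>x. x)"
  proof (rule finite_borel_measure_eqI_continuous)
    show "finite_measure (distr \<mu> borel T)" by (rule M.finite_measure_distr) simp
    show "finite_measure (distr \<nu> borel (\<lambda>x. x))" by (rule N.finite_measure_distr) simp
    fix g :: "real ^ 'n \<Rightarrow> real"
    assume g: "continuous_on UNIV g" "\<And>x. 0 \<le> g x \<and> g x \<le> 1"
    have g_meas [measurable]: "g \<in> borel_measurable borel"
      using g(1) by (rule borel_measurable_continuous_onI)
    have g_lim: "(\<lambda>k. g (y k)) \<longlonglongrightarrow> g l" if "y \<longlonglongrightarrow> l" for y l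
      using continuous_on_tendsto_compose[OF g(1) that] by simp
    have 1: "(\<lambda>k. \<integral>u. g (S (r k) u) \<partial>\<mu>) \<longlonglongrightarrow> (\<integral>u. g (T u) \<partial>\<mu>)"
    proof (rule integral_dominated_convergence[where w = "\<lambda>_. 1"])
      show "AE u in \<mu>. (\<lambda>k. g (S (r k) u)) \<longlonglongrightarrow> g (T u)"
        using AE_D by eventually_elim (use g_lim lim in \<open>simp add: T_def\<close>)
      show "(\<lambda>u. g (S (r k) u)) \<in> borel_measurable \<mu>" for k using S_meas by measurable
    qed (use g(2) in auto)
    have 2: "(\<lambda>k. \<integral>x. g (f (r k) x) \<partial>\<nu>) \<longlonglongrightarrow> (\<integral>x. g x \<partial>\<nu>)"
    proof (rule integral_dominated_convergence[where w = "\<lambda>_. 1"])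
      show "AE x in \<nu>. (\<lambda>k. g (f (r k) x)) \<longlonglongrightarrow> g x"
      proof (rule AE_I2)
        fix x assume "x \<in> space \<nu>"
        then have "(\<lambda>k. f (r k) x) \<longlonglongrightarrow> x"
          using LIMSEQ_subseq_LIMSEQ[OF f(3) r] spaceN by (simp add: o_def)
        then show "(\<lambda>k. g (f (r k) x)) \<longlonglongrightarrow> g x" by (rule g_lim)
      qed
      show "(\<lambda>x. g (f (r k) x)) \<in> borel_measurable \<nu>" for k
        using borel_measurable_simple_function[OF f(1)] by measurable
      show "g \<in> borel_measurable \<nu>" using id_meas g_meas by measurable
    qed (use g(2) in auto)
    have "(\<integral>u. g (T u) \<partial>\<mu>) = (\<integral>x. g x \<partial>\<nu>)"
      using 1 2 unfolding int by (rule LIMSEQ_unique)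
    then show "(\<integral>x. g x \<partial>distr \<mu> borel T) = (\<integral>x. g x \<partial>distr \<nu> borel (\<lambda>x. x))"
      by (simp add: integral_distr)
  qed simp_all
  then have T_distr: "emeasure \<mu> (T -` \<eta> \<inter> space \<mu>) = emeasure \<nu> \<eta>" if "\<eta> \<in> sets borel" "\<eta> \<subseteq> Omega C" for \<eta>
  proof -
    have "emeasure (distr \<mu> borel T) \<eta> = emeasure (distr \<nu> borel (\<lambda>x. x)) \<eta>"
      using \<open>distr \<mu> borel T = distr \<nu> borel (\<lambda>x. x)\<close> by simp
    moreover have "(\<lambda>x. x) -` \<eta> \<inter> space \<nu> = \<eta>" using that(2) spaceN by auto
    ultimately show ?thesis using that(1) by (simp add: emeasure_distr)
  qed
  show ?thesis
  proof (intro exI[of _ K] conjI allI impI K)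
    fix \<eta> :: "(real ^ 'n) set" assume eta: "\<eta> \<in> sets borel \<and> \<eta> \<subseteq> Omega C"
    \<comment> \<open>The intersection with D matters: outside D the map T takes the value
      \<open>v0\<close>, which may belong to \<eta>.\<close>
    have pre: "reverse_radial_gauss_preimage C K \<eta> = (T -` \<eta> \<inter> space \<mu>) \<inter> D"
      unfolding reverse_radial_gauss_preimage_def D_def[symmetric] T_def spaceM by (auto simp: D_def)
    have T_sets: "T -` \<eta> \<inter> space \<mu> \<in> sets \<mu>" using T_meas eta by (intro measurable_sets) auto
    then show "reverse_radial_gauss_preimage C K \<eta> \<in> sets \<mu>" unfolding pre by simp
    have "emeasure \<mu> (reverse_radial_gauss_preimage C K \<eta>) = emeasure \<mu> (T -` \<eta> \<inter> space \<mu>)"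
      unfolding pre using T_sets AE_D by (intro emeasure_eq_AE) (auto elim: AE_mp)
    then show "emeasure \<mu> (reverse_radial_gauss_preimage C K \<eta>) = emeasure \<nu> \<eta>"
      using T_distr eta by simp
  qed
qed

end
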